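(* The set of parameters $c\in\partial M\cap\mathbb{R}$ for which the quadratic polynomial $Q_c$ is critically non-recurrent has Hausdorff dimension $1$.
   Context: For $c\in\mathbb{C}$ let $Q_c(z)=z^2+c$. The Mandelbrot set $M$ is the set of $c\in\mathbb{C}$ for which the Julia set of $Q_c$ is connected, and $\partial M$ is its topological boundary in $\mathbb{C}$. $Q_c$ (or the parameter $c$) is called critically non-recurrent if the critical point $0$ does not belong to the closure of its forward orbit $\{Q_c^{\circ n}(0)\}_{n\ge1}$. *)

theory Defs
  imports "HOL-Analysis.Analysis"
begin

section \<open>Quadratic polynomials\<close>

definition Q :: "complex \<Rightarrow> complex \<Rightarrow> complex" where
  "Q c z = z ^ 2 + c"

definition filled_julia :: "complex \<Rightarrow> complex set" where
  "filled_julia c = {z. bounded (range (\<lambda>n. (Q c ^^ n) z))}"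

text \<open>The Julia set of a polynomial is the boundary of its filled Julia set.\<close>

definition julia :: "complex \<Rightarrow> complex set" where
  "julia c = frontier (filled_julia c)"

definition mandelbrot :: "complex set" where
  "mandelbrot = {c. connected (julia c)}"

definition critically_non_recurrent :: "complex \<Rightarrow> bool" where
  "critically_non_recurrent c \<longleftrightarrow> 0 \<notin> closure {(Q c ^^ n) 0 | n. n \<ge> 1}"


section \<open>Hausdorff measure and dimension\<close>

text \<open>
  \<open>diam_pow s U\<close> is the \<open>s\<close>-th power of the diameter of a bounded set \<open>U\<close>, with the
  conventions that the empty set contributes \<open>0\<close> for every \<open>s\<close>, and that every nonempty set
  contributes \<open>1\<close> for \<open>s = 0\<close> (in HOL, \<open>0 powr 0 = 0\<close>), so that the \<open>0\<close>-dimensional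
  Hausdorff measure is the counting measure.
\<close>

definition diam_pow :: "real \<Rightarrow> 'a::metric_space set \<Rightarrow> ennreal" where
  "diam_pow s U = (if U = {} then 0 else if s = 0 then 1 else ennreal (diameter U powr s))"

text \<open>
  Boundedness of the covering sets is required explicitly because \<open>diameter\<close> is real-valued
  and unspecified on unbounded sets. Finite covers are included by padding with empty sets.
\<close>

definition delta_covers :: "real \<Rightarrow> 'a::metric_space set \<Rightarrow> (nat \<Rightarrow> 'a set) set" where
  "delta_covers \<delta> A = {U. A \<subseteq> (\<Union>i. U i) \<and> (\<forall>i. bounded (U i) \<and> diameter (U i) \<le> \<delta>)}"

definition hausdorff_premeasure :: "real \<Rightarrow> real \<Rightarrow> 'a::metric_space set \<Rightarrow> ennreal" where
  "hausdorff_premeasure s \<delta> A = (INF U\<in>delta_covers \<delta> A. \<Sum>i. diam_pow s (U i))"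

definition hausdorff_measure :: "real \<Rightarrow> 'a::metric_space set \<Rightarrow> ennreal" where
  "hausdorff_measure s A = (SUP \<delta>\<in>{0<..}. hausdorff_premeasure s \<delta> A)"

definition hausdorff_dim :: "'a::metric_space set \<Rightarrow> ennreal" where
  "hausdorff_dim A = Inf {ennreal s | s. s \<ge> 0 \<and> hausdorff_measure s A = 0}"

end

theory Submission
  imports Defs "HOL-Complex_Analysis.Complex_Analysis"
begin

text \<open>
  The dimension is at most \<open>1\<close> because the set lies in a bounded part of the real line. For the
  lower bound it suffices, for every \<open>s < 1\<close>, to attach to almost every \<open>\<theta> \<in> [0, 1)\<close> a parameter
  \<open>p \<theta>\<close> of the set with \<open>\<bar>\<theta> - \<theta>'\<bar> \<le> K * \<bar>p \<theta> - p \<theta>'\<bar>^s\<close>; then the \<open>s\<close>-dimensional measure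
  is positive (\<open>hausdorff_measure_nonzero_if_holder_chart\<close>).

  The parameters are taken just above \<open>-2\<close>. The polynomial \<open>z^2 - 2\<close> is conjugate to angle
  doubling: its entropy and its expansion rate are both \<open>log 2\<close>, and this quotient \<open>1\<close> is the
  dimension. The binary digits of \<open>\<theta>\<close> are written into a pattern of signs, with a negative sign
  forced every \<open>k\<close> steps, and \<open>p \<theta>\<close> is a parameter whose critical orbit, from some common time \<open>N\<close>
  on, has this sign pattern. The forced signs keep the orbit away from \<open>\<plusminus>2\<close>, hence away from the
  critical point \<open>0\<close>, whose image is close to \<open>-2\<close>; so \<open>p \<theta>\<close> is non-recurrent. They reduce the
  entropy only by the factor \<open>1 - 1/k\<close>. Parameters for all patterns exist by the intermediate value
  theorem (\<open>sign_pattern_realised\<close>).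

  If the patterns of \<open>\<theta>\<close> and \<open>\<theta>'\<close> first differ at time \<open>n\<close>, then \<open>\<theta>\<close> and \<open>\<theta>'\<close> agree to about
  \<open>(1 - 1/k) n\<close> binary digits. The orbits of \<open>p \<theta>\<close> and \<open>p \<theta>'\<close> are then a definite distance
  apart, and since orbit differences grow at most like \<open>\<Lambda>^n\<close> with \<open>\<Lambda>\<close> as close to \<open>2\<close> as desired
  (\<open>orbit_separation_bound\<close>), the parameters differ by at least a constant times \<open>\<Lambda>^(-n)\<close>. This
  is the required inequality.

  It remains to see that \<open>p \<theta>\<close> is a boundary point of the Mandelbrot set. It belongs to the
  Mandelbrot set because its critical orbit is bounded. If it is an interior point, then the
  critical orbits of nearby complex parameters are bounded too, so by Cauchy's estimate they depend
  on the parameter in a uniformly Lipschitz way; as the orbits of any two of the chosen parameters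
  separate, \<open>p \<theta>\<close> is isolated among the chosen interior points. This excludes only countably many
  \<open>\<theta>\<close>. Both steps use that the Julia set is connected exactly if the critical orbit is bounded,
  which is proved from the maximum principle, the unicoherence of the plane, and the existence
  of a continuous branch of \<open>sqrt (z - c)\<close> on the filled Julia set when \<open>c\<close> escapes.
\<close>

section \<open>Hausdorff dimension of subsets of the real line\<close>

text \<open>
  Cutting \<open>[-a, a]\<close> into \<open>n\<close> equal pieces costs \<open>n * (2a/n)^s\<close>, which tends to \<open>0\<close>
  for \<open>s > 1\<close>.
\<close>

lemma hausdorff_measure_bounded_real_eq_0:
  fixes S :: "complex set"
  assumes S: "S \<subseteq> \<real>" "S \<subseteq> cball 0 a" and a: "a > 0" and s: "s > 1"
  shows "hausdorff_measure s S = 0"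
proof -
  have "hausdorff_premeasure s \<delta> S = 0" if \<delta>: "\<delta> > 0" for \<delta>
  proof -
    define r where "r n = 2 * a / real n" for n :: nat
    define L where "L n i = -a + r n * real i" for n i :: nat
    define U where "U n i = (if i < n then complex_of_real ` {L n i..L n (Suc i)} else {})"
      for n i :: nat
    have L_Suc: "L n (Suc i) = L n i + r n" for n i
      by (simp add: L_def algebra_simps)
    have bdd: "bounded (U n i)" for n i
      unfolding U_def
      by (auto intro!: compact_imp_bounded compact_continuous_image continuous_intros)
    have diam: "diameter (U n i) \<le> r n" if "n > 0" for n i
    proof (rule diameter_le)
      show "U n i \<noteq> {} \<or> 0 \<le> r n"
        using a by (simp add: r_def)
      show "norm (x - y) \<le> r n" if "x \<in> U n i" "y \<in> U n i" for x y
        using that by (auto simp: U_def L_Suc simp flip: of_real_diff split: if_splits)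
    qed
    have cover: "S \<subseteq> (\<Union>i. U n i)" if n: "n > 0" for n
    proof
      fix z assume z: "z \<in> S"
      obtain x where x: "z = complex_of_real x" "-a \<le> x" "x \<le> a"
        using S z by (auto elim!: Reals_cases dest!: subsetD)
      have r: "r n > 0" using a n by (simp add: r_def)
      define i where "i = min (nat \<lfloor>(x + a) / r n\<rfloor>) (n - 1)"
      have i_less: "i < n" using n by (simp add: i_def min_def) linarith
      have "L n i \<le> x"
      proof -
        have "real i \<le> (x + a) / r n"
          unfolding i_def using x r by (simp add: min_def le_nat_iff) linarith
        thus ?thesis using r by (simp add: L_def field_simps)
      qed
      moreover have "x \<le> L n (Suc i)"
      proof (cases "nat \<lfloor>(x + a) / r n\<rfloor> \<le> n - 1")
        case True
        hence "real (Suc i) \<ge> (x + a) / r n"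
          unfolding i_def using x r by (simp add: min_def) linarith
        thus ?thesis using r by (simp add: L_def field_simps)
      next
        case False
        hence "L n (Suc i) = a"
          using n by (simp add: L_def i_def min_def r_def)
        thus ?thesis using x by simp
      qed
      ultimately show "z \<in> (\<Union>i. U n i)"
        using i_less x by (auto simp: U_def)
    qed
    have le: "hausdorff_premeasure s \<delta> S \<le> ennreal (real n * r n powr s)"
      if n: "n > 0" "r n \<le> \<delta>" for n
    proof -
      have "U n \<in> delta_covers \<delta> S"
        unfolding delta_covers_def
        using cover[OF n(1)] bdd order_trans[OF diam[OF n(1)] n(2)] by blast
      hence "hausdorff_premeasure s \<delta> S \<le> (\<Sum>i. diam_pow s (U n i))"
        unfolding hausdorff_premeasure_def by (rule INF_lower)
      also have "\<dots> = (\<Sum>i<n. diam_pow s (U n i))"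
        by (rule suminf_finite) (auto simp: U_def diam_pow_def)
      also have "\<dots> \<le> (\<Sum>i<n. ennreal (r n powr s))"
        using s diam[of n] n diameter_ge_0[OF bdd]
        by (intro sum_mono) (auto simp: diam_pow_def intro!: ennreal_leI powr_mono2)
      also have "\<dots> = ennreal (real n * r n powr s)"
        by (simp add: ennreal_mult ennreal_of_nat_eq_real_of_nat)
      finally show ?thesis .
    qed
    have r_eq: "real n * r n powr s = (2 * a) powr s * real n powr (1 - s)" if "n > 0" for n
      using that a by (simp add: r_def powr_divide powr_diff)
    have "((\<lambda>n. (2 * a) powr s * real n powr (1 - s)) \<longlongrightarrow> (2 * a) powr s * 0) sequentially"
      using s by (intro tendsto_mult tendsto_const tendsto_neg_powr filterlim_real_sequentially) auto
    moreover have "\<forall>\<^sub>F n in sequentially. (2 * a) powr s * real n powr (1 - s) = real n * r n powr s"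
      using eventually_gt_at_top[of 0] by eventually_elim (simp add: r_eq)
    ultimately have "((\<lambda>n. real n * r n powr s) \<longlongrightarrow> 0) sequentially"
      using Lim_transform_eventually by fastforce
    hence "((\<lambda>n. ennreal (real n * r n powr s)) \<longlongrightarrow> ennreal 0) sequentially"
      by (rule tendsto_ennrealI)
    moreover have "\<forall>\<^sub>F n in sequentially. hausdorff_premeasure s \<delta> S \<le> ennreal (real n * r n powr s)"
    proof -
      have "(\<lambda>n. r n) \<longlonglongrightarrow> 0"
        unfolding r_def by (rule lim_const_over_n)
      hence "\<forall>\<^sub>F n in sequentially. r n < \<delta>"
        using \<delta> by (rule order_tendstoD)
      with eventually_gt_at_top[of 0] show ?thesis
        by eventually_elim (auto intro: le)
    qed
    ultimately have "hausdorff_premeasure s \<delta> S \<le> ennreal 0"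
      by (intro tendsto_lowerbound) auto
    thus ?thesis by simp
  qed
  thus ?thesis
    unfolding hausdorff_measure_def by (simp add: SUP_eq_const)
qed

text \<open>
  A set whose points label almost every \<open>x \<in> [0, 1)\<close>, in such a way that the label determines
  \<open>x\<close> in an \<open>s\<close>-Hoelder manner, is large: pulling back a cover \<open>U\<close> of the set gives a cover of
  \<open>[0, 1)\<close> up to a null set by sets of diameter at most \<open>C * diam (U i)^s\<close>, and Lebesgue
  measure bounds the sum of these from below.
\<close>

lemma hausdorff_measure_nonzero_if_holder_chart:
  fixes \<gamma> :: "real \<Rightarrow> 'a::metric_space"
  assumes E: "countable E" and s: "s \<ge> 0" and C: "C > 0"
    and chart: "\<And>x. x \<in> {0..<1} - E \<Longrightarrow> \<gamma> x \<in> A"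
    and holder: "\<And>x y. x \<in> {0..<1} \<Longrightarrow> y \<in> {0..<1} \<Longrightarrow> x \<noteq> y \<Longrightarrow>
                   \<bar>x - y\<bar> \<le> C * dist (\<gamma> x) (\<gamma> y) powr s"
  shows "hausdorff_measure s A \<noteq> 0"
proof -
  have D_meas: "{0..<1} - E \<in> sets lborel" and D: "emeasure lborel ({0..<1} - E) = 1"
  proof -
    have E': "E \<in> null_sets lborel" using E by (rule countable_imp_null_set_lborel)
    thus "{0..<1} - E \<in> sets lborel" by auto
    show "emeasure lborel ({0..<1} - E) = 1"
      using emeasure_Diff_null_set[OF E', of "{0..<1}"] by simp
  qed
  have mass: "1 \<le> ennreal (2 * C) * (\<Sum>i. diam_pow s (U i))" if U: "U \<in> delta_covers 1 A" for U
  proof -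
    define V where "V i = {x \<in> {0..<1} - E. \<gamma> x \<in> U i}" for i
    have ex: "\<exists>B. B \<in> sets lborel \<and> V i \<subseteq> B \<and> emeasure lborel B \<le> ennreal (2 * C) * diam_pow s (U i)" for i
    proof (cases "V i = {}")
      case True
      thus ?thesis by (intro exI[of _ "{}"]) auto
    next
      case False
      then obtain x0 where x0: "x0 \<in> V i" by auto
      \<comment> \<open>\<open>diam_pow 0\<close> counts nonempty sets, although \<open>0 powr 0 = 0\<close>\<close>
      define r where "r = C * (if s = 0 then 1 else diameter (U i) powr s)"
      have bdd: "bounded (U i)" using U by (auto simp: delta_covers_def)
      have dp: "diam_pow s (U i) = ennreal (if s = 0 then 1 else diameter (U i) powr s)"
        using x0 by (auto simp: diam_pow_def V_def)
      have r0: "r \<ge> 0" using C by (simp add: r_def)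
      have "V i \<subseteq> {x0 - r..x0 + r}"
      proof
        fix x assume x: "x \<in> V i"
        have d: "dist (\<gamma> x0) (\<gamma> x) \<le> diameter (U i)"
          using x x0 bdd by (intro diameter_bounded_bound) (auto simp: V_def)
        have "\<bar>x0 - x\<bar> \<le> r"
        proof (cases "x = x0")
          case False
          hence "\<bar>x0 - x\<bar> \<le> C * dist (\<gamma> x0) (\<gamma> x) powr s"
            using x x0 by (intro holder) (auto simp: V_def)
          also have "dist (\<gamma> x0) (\<gamma> x) powr s \<le> (if s = 0 then 1 else diameter (U i) powr s)"
            using d s by (auto intro: powr_mono2)
          finally show ?thesis using C by (simp add: r_def)
        qed (use r0 in auto)
        thus "x \<in> {x0 - r..x0 + r}" by auto
      qed
      moreover have "emeasure lborel {x0 - r..x0 + r} \<le> ennreal (2 * C) * diam_pow s (U i)"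
        using r0 C by (simp add: dp r_def flip: ennreal_mult)
      ultimately show ?thesis by (intro exI[of _ "{x0 - r..x0 + r}"]) auto
    qed
    then obtain B where B: "\<And>i. B i \<in> sets lborel" "\<And>i. V i \<subseteq> B i"
      "\<And>i. emeasure lborel (B i) \<le> ennreal (2 * C) * diam_pow s (U i)"
      by metis
    have "{0..<1} - E \<subseteq> (\<Union>i. B i)"
    proof
      fix x assume x: "x \<in> {0..<1} - E"
      then obtain i where "\<gamma> x \<in> U i"
        using chart[OF x] U by (auto simp: delta_covers_def)
      with x B(2)[of i] show "x \<in> (\<Union>i. B i)" by (auto simp: V_def)
    qed
    hence "1 \<le> emeasure lborel (\<Union>i. B i)"
      using D B(1) by (metis emeasure_mono sets.countable_UN' sets.countable_UN image_subsetI top_greatest)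
    also have "\<dots> \<le> (\<Sum>i. emeasure lborel (B i))"
      using B(1) by (intro emeasure_subadditive_countably) auto
    also have "\<dots> \<le> (\<Sum>i. ennreal (2 * C) * diam_pow s (U i))"
      by (intro suminf_le B) auto
    also have "\<dots> = ennreal (2 * C) * (\<Sum>i. diam_pow s (U i))"
      by simp
    finally show ?thesis .
  qed
  have "ennreal (1 / (2 * C)) \<le> (\<Sum>i. diam_pow s (U i))" if U: "U \<in> delta_covers 1 A" for U
  proof -
    have "ennreal (1 / (2 * C)) \<le> ennreal (1 / (2 * C)) * (ennreal (2 * C) * (\<Sum>i. diam_pow s (U i)))"
      using mult_left_mono[OF mass[OF U], of "ennreal (1 / (2 * C))"]
      by simp
    also have "\<dots> = (\<Sum>i. diam_pow s (U i))"
      using C by (simp add: mult.assoc[symmetric] flip: ennreal_mult)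
    finally show ?thesis .
  qed
  hence "ennreal (1 / (2 * C)) \<le> hausdorff_premeasure s 1 A"
    unfolding hausdorff_premeasure_def by (intro INF_greatest)
  also have "\<dots> \<le> hausdorff_measure s A"
    unfolding hausdorff_measure_def by (rule SUP_upper) auto
  finally have "ennreal (1 / (2 * C)) \<le> hausdorff_measure s A" .
  thus ?thesis using C by (auto simp: ennreal_eq_0_iff)
qed

lemma hausdorff_dim_eq_1:
  fixes S :: "'a::metric_space set"
  assumes "\<And>s. s > 1 \<Longrightarrow> hausdorff_measure s S = 0"
    and "\<And>s. 0 \<le> s \<Longrightarrow> s < 1 \<Longrightarrow> hausdorff_measure s S \<noteq> 0"
  shows "hausdorff_dim S = 1"
proof (rule antisym)
  show "hausdorff_dim S \<le> 1"
  proof (rule ennreal_le_epsilon)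
    fix e :: real assume "e > 0"
    hence "hausdorff_dim S \<le> ennreal (1 + e)"
      unfolding hausdorff_dim_def using assms(1)[of "1 + e"]
      by (intro Inf_lower CollectI exI[of _ "1 + e"]) auto
    thus "hausdorff_dim S \<le> 1 + ennreal e"
      using \<open>e > 0\<close> by (simp add: ennreal_plus)
  qed
  show "1 \<le> hausdorff_dim S"
    unfolding hausdorff_dim_def
  proof (rule Inf_greatest)
    fix x assume "x \<in> {ennreal s |s. s \<ge> 0 \<and> hausdorff_measure s S = 0}"
    then obtain s where "x = ennreal s" "s \<ge> 0" "hausdorff_measure s S = 0" by blast
    with assms(2)[of s] show "1 \<le> x" by force
  qed
qed

lemma countable_isolated_points:
  fixes S :: "'a::second_countable_topology set"
  assumes "\<And>x. x \<in> S \<Longrightarrow> \<exists>T. open T \<and> T \<inter> S = {x}"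
  shows "countable S"
proof -
  obtain B :: "'a set set" where B: "countable B" "topological_basis B"
    using ex_countable_basis by blast
  have "\<exists>b\<in>B. b \<inter> S = {x}" if x: "x \<in> S" for x
  proof -
    obtain T where T: "open T" "T \<inter> S = {x}" using assms[OF x] by blast
    then obtain b where "b \<in> B" "x \<in> b" "b \<subseteq> T"
      using topological_basisE[OF B(2)] by blast
    with T x show ?thesis by blast
  qed
  have "S \<subseteq> (\<lambda>b. the_elem (b \<inter> S)) ` B"
  proof
    fix x assume "x \<in> S"
    then obtain b where b: "b \<in> B" "b \<inter> S = {x}"
      using \<open>\<And>x. x \<in> S \<Longrightarrow> \<exists>b\<in>B. b \<inter> S = {x}\<close> by blast
    have "x = the_elem (b \<inter> S)"
      unfolding b(2) by simp
    with b(1) show "x \<in> (\<lambda>b. the_elem (b \<inter> S)) ` B"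
      by (rule rev_image_eqI)
  qed
  thus ?thesis
    using B(1) countable_subset by blast
qed


section \<open>The dichotomy for quadratic Julia sets\<close>

lemma Q_minus [simp]: "Q c (- z) = Q c z"
  by (simp add: Q_def)

lemma continuous_on_Q_iterate: "continuous_on S (Q c ^^ n)"
proof (induction n)
  case (Suc n)
  have "continuous_on S (\<lambda>z. (Q c ^^ n) z ^ 2 + c)"
    by (intro continuous_intros Suc)
  thus ?case by (simp add: Q_def[of c "(Q c ^^ n) _"])
qed (simp add: id_def)

lemma holomorphic_on_Q_iterate: "(Q c ^^ n) holomorphic_on S"
proof (induction n)
  case (Suc n)
  have "(\<lambda>z. (Q c ^^ n) z ^ 2 + c) holomorphic_on S"
    by (intro holomorphic_intros Suc)
  thus ?case by (simp add: Q_def[of c "(Q c ^^ n) _"])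
qed (simp add: id_def holomorphic_on_ident)

lemma holomorphic_on_critical_orbit: "(\<lambda>c. (Q c ^^ n) 0) holomorphic_on S"
proof (induction n)
  case (Suc n)
  have "(\<lambda>c. ((Q c ^^ n) 0) ^ 2 + c) holomorphic_on S"
    by (intro holomorphic_intros Suc)
  thus ?case by (simp add: Q_def[of _ "(Q _ ^^ n) 0"])
qed auto

subsection \<open>The escape radius\<close>

definition escape_radius :: "complex \<Rightarrow> real" where
  "escape_radius c = cmod c + 2"

lemma norm_Q_outside_escape_radius:
  assumes "cmod z > escape_radius c"
  shows "cmod (Q c z) \<ge> 2 * cmod z"
proof -
  have "cmod z * (cmod c + 2) \<le> cmod z * cmod z"
    using assms by (intro mult_left_mono) (auto simp: escape_radius_def)
  moreover have "cmod c * 1 \<le> cmod c * cmod z"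
  proof (rule mult_left_mono)
    show "1 \<le> cmod z"
      using assms norm_ge_zero[of c] unfolding escape_radius_def by linarith
  qed simp
  moreover have "cmod (z ^ 2) - cmod c \<le> cmod (Q c z)"
    unfolding Q_def by (metis diff_minus_eq_add norm_minus_cancel norm_triangle_ineq2)
  ultimately show ?thesis
    by (simp add: norm_mult power2_eq_square algebra_simps)
qed

lemma unbounded_orbit_outside_escape_radius:
  assumes "cmod ((Q c ^^ m) z) > escape_radius c"
  shows "\<not> bounded (range (\<lambda>n. (Q c ^^ n) z))"
proof
  have R: "escape_radius c > 1" by (simp add: escape_radius_def add.commute add_pos_nonneg)
  have grow: "cmod ((Q c ^^ (n + m)) z) \<ge> 2 ^ n * cmod ((Q c ^^ m) z)" for n
  proof (induction n)
    case (Suc n)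
    have "1 * cmod ((Q c ^^ m) z) \<le> 2 ^ n * cmod ((Q c ^^ m) z)"
      by (intro mult_right_mono) auto
    hence "cmod ((Q c ^^ (n + m)) z) > escape_radius c"
      using Suc assms by linarith
    from norm_Q_outside_escape_radius[OF this] Suc show ?case by simp
  qed simp
  assume "bounded (range (\<lambda>n. (Q c ^^ n) z))"
  then obtain B where B: "\<And>n. cmod ((Q c ^^ n) z) \<le> B"
    by (auto simp: bounded_iff)
  obtain n where n: "B < 2 ^ n" using real_arch_pow[of 2 B] by auto
  have "2 ^ n * 1 \<le> 2 ^ n * cmod ((Q c ^^ m) z)"
    using assms R by (intro mult_left_mono) auto
  with grow[of n] B[of "n + m"] n show False by simp
qed

lemma filled_julia_iff: "z \<in> filled_julia c \<longleftrightarrow> (\<forall>n. cmod ((Q c ^^ n) z) \<le> escape_radius c)"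
proof
  assume "z \<in> filled_julia c"
  thus "\<forall>n. cmod ((Q c ^^ n) z) \<le> escape_radius c"
    unfolding filled_julia_def mem_Collect_eq
    using unbounded_orbit_outside_escape_radius[of c _ z] not_less by blast
next
  assume "\<forall>n. cmod ((Q c ^^ n) z) \<le> escape_radius c"
  thus "z \<in> filled_julia c"
    by (auto simp: filled_julia_def bounded_iff)
qed

lemma Q_in_filled_julia_iff [simp]: "Q c z \<in> filled_julia c \<longleftrightarrow> z \<in> filled_julia c"
proof -
  have *: "(Q c ^^ n) (Q c z) = (Q c ^^ Suc n) z" for n
    by (simp add: funpow_swap1)
  have "bounded (range (\<lambda>n. (Q c ^^ Suc n) z)) \<longleftrightarrow> bounded (range (\<lambda>n. (Q c ^^ n) z))"
  proof
    assume "bounded (range (\<lambda>n. (Q c ^^ Suc n) z))"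
    hence "bounded (insert z (range (\<lambda>n. (Q c ^^ Suc n) z)))" by simp
    moreover have "range (\<lambda>n. (Q c ^^ n) z) \<subseteq> insert z (range (\<lambda>n. (Q c ^^ Suc n) z))"
    proof
      fix w assume "w \<in> range (\<lambda>n. (Q c ^^ n) z)"
      then obtain n where "w = (Q c ^^ n) z" by auto
      thus "w \<in> insert z (range (\<lambda>n. (Q c ^^ Suc n) z))" by (cases n) auto
    qed
    ultimately show "bounded (range (\<lambda>n. (Q c ^^ n) z))"
      using bounded_subset by blast
  next
    assume "bounded (range (\<lambda>n. (Q c ^^ n) z))"
    moreover have "range (\<lambda>n. (Q c ^^ Suc n) z) \<subseteq> range (\<lambda>n. (Q c ^^ n) z)"
      by blast
    ultimately show "bounded (range (\<lambda>n. (Q c ^^ Suc n) z))"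
      using bounded_subset by blast
  qed
  thus ?thesis
    unfolding filled_julia_def mem_Collect_eq * .
qed

lemma minus_in_filled_julia_iff [simp]: "- z \<in> filled_julia c \<longleftrightarrow> z \<in> filled_julia c"
  by (metis Q_in_filled_julia_iff Q_minus)

definition level_set :: "complex \<Rightarrow> nat \<Rightarrow> complex set" where
  "level_set c n = {z. cmod ((Q c ^^ n) z) \<le> escape_radius c}"

lemma filled_julia_eq_INT_level_set: "filled_julia c = \<Inter> (range (level_set c))"
  by (auto simp: filled_julia_iff level_set_def)

lemma level_set_0: "level_set c 0 = cball 0 (escape_radius c)"
  by (auto simp: level_set_def)

lemma level_set_Suc: "level_set c (Suc n) = Q c -` level_set c n"
  by (simp add: level_set_def vimage_def funpow_swap1)

lemma level_set_antimono: "m \<le> n \<Longrightarrow> level_set c n \<subseteq> level_set c m"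
proof (induction n rule: dec_induct)
  case (step n)
  have "level_set c (Suc n) \<subseteq> level_set c n"
  proof
    fix z assume "z \<in> level_set c (Suc n)"
    thus "z \<in> level_set c n"
      using norm_Q_outside_escape_radius[of c "(Q c ^^ n) z"] norm_ge_zero[of "(Q c ^^ n) z"]
      by (cases "cmod ((Q c ^^ n) z) \<le> escape_radius c") (auto simp: level_set_def)
  qed
  with step show ?case by blast
qed simp

lemma compact_level_set: "compact (level_set c n)"
proof -
  have "level_set c n = (\<lambda>z. cmod ((Q c ^^ n) z)) -` {..escape_radius c}"
    by (auto simp: level_set_def)
  moreover have "closed \<dots>"
    by (intro closed_vimage continuous_on_norm continuous_on_Q_iterate) auto
  moreover have "bounded (level_set c n)"
    using level_set_antimono[of 0 n c] bounded_cball bounded_subset unfolding level_set_0 by blast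
  ultimately show ?thesis
    by (simp add: compact_eq_bounded_closed)
qed

lemma compact_filled_julia: "compact (filled_julia c)"
  unfolding filled_julia_eq_INT_level_set
  by (rule compact_Inter) (auto simp: compact_level_set)

lemma filled_julia_nonempty: "filled_julia c \<noteq> {}"
proof -
  define z where "z = (1 + csqrt (1 - 4 * c)) / 2"
  have "z ^ 2 = (1 + 2 * csqrt (1 - 4 * c) + (csqrt (1 - 4 * c))\<^sup>2) / 4"
    by (simp add: z_def power2_eq_square field_simps)
  hence "z ^ 2 = z - c"
    unfolding power2_csqrt by (simp add: z_def field_simps)
  hence fixed: "Q c z = z" by (simp add: Q_def)
  have "(Q c ^^ n) z = z" for n
    by (induction n) (auto simp: fixed)
  hence "z \<in> filled_julia c" by (simp add: filled_julia_def)
  thus ?thesis by blast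
qed

subsection \<open>A bounded critical orbit gives a connected Julia set\<close>

text \<open>
  The two preimages \<open>\<plusminus>z\<close> of a point merge only over the critical value \<open>c\<close>. A separation of the
  preimage can be made symmetric under \<open>z \<mapsto> -z\<close> by enlarging the part that misses \<open>0\<close>,
  and a symmetric separation pushes forward to a separation of \<open>D\<close>.
\<close>

lemma connected_Q_vimage:
  assumes D: "compact D" "connected D" "c \<in> D"
  shows "connected (Q c -` D)"
proof (rule ccontr)
  assume "\<not> connected (Q c -` D)"
  have cont: "continuous_on S (Q c)" for S
    unfolding Q_def by (intro continuous_intros)
  have closed_pre: "closed (Q c -` D)"
    using D(1) by (intro closed_vimage compact_imp_closed cont)
  from \<open>\<not> connected (Q c -` D)\<close> obtain A B where AB: "closed A" "closed B" "A \<union> B = Q c -` D"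
      "A \<inter> B = {}" "A \<noteq> {}" "B \<noteq> {}"
    using connected_closed_set[OF closed_pre] by metis
  have 0: "0 \<in> Q c -` D" using D(3) by (simp add: Q_def)
  obtain M where M: "\<And>w. w \<in> D \<Longrightarrow> cmod w \<le> M"
    using compact_imp_bounded[OF D(1)] by (auto simp: bounded_iff)
  have "cmod z \<le> max 1 (M + cmod c)" if "z \<in> Q c -` D" for z
  proof (cases "cmod z \<le> 1")
    case False
    have "cmod z * 1 \<le> cmod z * cmod z"
      using False by (intro mult_left_mono) auto
    also have "\<dots> = cmod (Q c z - c)"
      by (simp add: Q_def norm_mult power2_eq_square)
    also have "\<dots> \<le> M + cmod c"
      using M[of "Q c z"] that norm_triangle_ineq4[of "Q c z" c] by simp
    finally show ?thesis by simp
  qed simp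
  hence "bounded (Q c -` D)" unfolding bounded_iff by blast
  with closed_pre have compact_pre: "compact (Q c -` D)"
    by (simp add: compact_eq_bounded_closed)
  have no_split: False
    if AB: "closed A" "closed B" "A \<union> B = Q c -` D" "A \<inter> B = {}" "B \<noteq> {}" "0 \<in> A" for A B
  proof -
    define A' where "A' = A \<inter> uminus ` A"
    define B' where "B' = B \<union> uminus ` B"
    have mem_A': "z \<in> A' \<longleftrightarrow> z \<in> A \<and> - z \<in> A" for z
      by (force simp: A'_def image_iff)
    have mem_B': "z \<in> B' \<longleftrightarrow> z \<in> B \<or> - z \<in> B" for z
      by (force simp: B'_def image_iff)
    have mem_pre: "z \<in> A \<or> z \<in> B \<longleftrightarrow> Q c z \<in> D" for z
      using AB(3) by auto
    have union: "A' \<union> B' = Q c -` D"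
    proof (intro set_eqI)
      fix z
      show "z \<in> A' \<union> B' \<longleftrightarrow> z \<in> Q c -` D"
        using mem_pre[of z] mem_pre[of "-z"] by (auto simp: mem_A' mem_B')
    qed
    have "closed A'" "closed B'"
      using AB by (auto simp: A'_def B'_def intro!: closed_Int closed_Un closed_negations)
    moreover have "A' = Q c -` D \<inter> A'" "B' = Q c -` D \<inter> B'"
      using union by auto
    ultimately have "compact A'" "compact B'"
      using compact_Int_closed[OF compact_pre] by metis+
    hence "compact (Q c ` A')" "compact (Q c ` B')"
      by (auto intro: compact_continuous_image cont)
    hence "closed (Q c ` A')" "closed (Q c ` B')"
      by (auto intro: compact_imp_closed)
    moreover have "Q c ` A' \<inter> Q c ` B' = {}"
    proof -
      have False if "a \<in> A'" "b \<in> B'" "Q c a = Q c b" for a b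
      proof -
        have "a = b \<or> a = - b" using that(3) by (simp add: Q_def power2_eq_iff)
        thus False using that(1,2) AB(4) by (auto simp: mem_A' mem_B')
      qed
      thus ?thesis by blast
    qed
    moreover have "Q c ` A' \<union> Q c ` B' = D"
    proof -
      have "w \<in> Q c ` (Q c -` D)" if "w \<in> D" for w
      proof -
        have "Q c (csqrt (w - c)) = w" by (simp add: Q_def)
        with that show ?thesis by (intro image_eqI[of _ _ "csqrt (w - c)"]) auto
      qed
      hence "Q c ` (Q c -` D) = D" by auto
      thus ?thesis by (simp add: union flip: image_Un)
    qed
    moreover have "Q c ` A' \<noteq> {}" "Q c ` B' \<noteq> {}"
      using AB(5,6) by (auto simp: A'_def B'_def image_iff)
    ultimately show False
      using D(2) connected_closed_set[OF compact_imp_closed[OF D(1)]] by blast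
  qed
  show False
  proof (cases "0 \<in> A")
    case True
    thus False using no_split[of A B] AB by blast
  next
    case False
    thus False using no_split[of B A] AB 0 by blast
  qed
qed

text \<open>
  On a bounded component of the complement every iterate is bounded by its values on the
  boundary, which lies in the filled Julia set.
\<close>

lemma connected_compl_filled_julia: "connected (- filled_julia c)"
proof (rule ccontr)
  assume "\<not> connected (- filled_julia c)"
  then obtain C where C: "C \<in> components (- filled_julia c)" "bounded C"
    using cobounded_has_bounded_component[of "- filled_julia c"] compact_filled_julia
    by (auto simp: compact_imp_bounded)
  have "frontier C \<subseteq> filled_julia c"
    using frontier_of_components_subset[OF C(1)] frontier_complement[of "filled_julia c"]
      frontier_subset_closed[OF compact_imp_closed[OF compact_filled_julia]] by (metis order_trans)
  have "cmod ((Q c ^^ n) z) \<le> escape_radius c" if "z \<in> C" for n z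
  proof (rule maximum_modulus_frontier[of "Q c ^^ n" C])
    show "cmod ((Q c ^^ n) w) \<le> escape_radius c" if "w \<in> frontier C" for w
      using that \<open>frontier C \<subseteq> filled_julia c\<close> filled_julia_iff by blast
  qed (use that C(2) holomorphic_on_Q_iterate continuous_on_Q_iterate in blast)+
  hence "C \<subseteq> filled_julia c" by (auto simp: filled_julia_iff)
  moreover have "C \<noteq> {}" "C \<subseteq> - filled_julia c"
    using in_components_nonempty[OF C(1)] in_components_subset[OF C(1)] by auto
  ultimately show False by blast
qed

theorem mandelbrot_if_critical_point_in_filled_julia:
  assumes "0 \<in> filled_julia c"
  shows "c \<in> mandelbrot"
proof -
  have c_mem: "c \<in> level_set c n" for n
  proof -
    have "Q c 0 \<in> filled_julia c" using assms by simp
    thus ?thesis by (simp add: Q_def filled_julia_eq_INT_level_set)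
  qed
  have "connected (level_set c n)" for n
  proof (induction n)
    case (Suc n)
    thus ?case unfolding level_set_Suc
      by (intro connected_Q_vimage compact_level_set c_mem)
  qed (simp add: level_set_0)
  hence "connected (filled_julia c)"
    unfolding filled_julia_eq_INT_level_set
    by (intro connected_nest compact_level_set level_set_antimono)
  thus ?thesis
    unfolding mandelbrot_def julia_def
    using connected_frontier_simple connected_compl_filled_julia by blast
qed

subsection \<open>An escaping critical orbit disconnects the Julia set\<close>

text \<open>
  If \<open>c\<close> escapes, it lies in the unbounded component of the complement of the filled Julia set,
  so \<open>z \<mapsto> z - c\<close> does not wind around \<open>0\<close> there and has a continuous logarithm.
\<close>

lemma continuous_sqrt_on_filled_julia:
  assumes "c \<notin> filled_julia c"
  obtains h where "continuous_on (filled_julia c) h"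
    "\<And>z. z \<in> filled_julia c \<Longrightarrow> h z ^ 2 = z - c"
proof -
  let ?K = "filled_julia c"
  let ?u = "\<lambda>z. inverse (norm (z - c)) *\<^sub>R (z - c)"
  have "connected_component_set (- ?K) c = - ?K"
    using assms by (intro connected_component_eq_self connected_compl_filled_julia) auto
  moreover have "\<not> bounded (- ?K)"
    using compact_imp_bounded[OF compact_filled_julia]
    by (metis bounded_Un Compl_partition not_bounded_UNIV)
  ultimately obtain a where "homotopic_with_canon (\<lambda>x. True) ?K (sphere 0 1) ?u (\<lambda>x. a)"
    using Borsuk_map_essential_bounded_component[OF compact_filled_julia assms] by auto
  hence "homotopic_with_canon (\<lambda>x. True) ?K (- {0}) ?u (\<lambda>x. a)"
    by (rule homotopic_with_subset_right) auto
  then obtain g where g: "continuous_on ?K g" "\<And>z. z \<in> ?K \<Longrightarrow> ?u z = exp (g z)"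
    using inessential_eq_continuous_logarithm[of ?K ?u] by auto
  define h where "h z = complex_of_real (sqrt (cmod (z - c))) * exp (g z / 2)" for z
  have "continuous_on ?K h"
    unfolding h_def by (intro continuous_intros g) auto
  moreover have "h z ^ 2 = z - c" if z: "z \<in> ?K" for z
  proof -
    have "h z ^ 2 = complex_of_real ((sqrt (cmod (z - c)))\<^sup>2) * exp (g z / 2 + g z / 2)"
      unfolding exp_add h_def of_real_power by (simp only: power2_eq_square mult_ac)
    also have "\<dots> = complex_of_real (cmod (z - c)) * ?u z"
      using g(2)[OF z] by simp
    also have "\<dots> = z - c"
    proof -
      have "z \<noteq> c" using z assms by auto
      thus ?thesis by (simp add: scaleR_conv_of_real)
    qed
    finally show ?thesis .
  qed
  ultimately show ?thesis using that by blast
qed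

lemma minus_in_julia_iff: "- z \<in> julia c \<longleftrightarrow> z \<in> julia c"
proof -
  have "- z \<in> julia c" if "z \<in> julia c" for z
  proof -
    have neg: "uminus ` filled_julia c = filled_julia c" "uminus ` (- filled_julia c) = - filled_julia c"
      using minus_in_filled_julia_iff[of _ c] by (auto intro: image_eqI[of _ uminus "- _"])
    have cl: "closure (uminus ` S) = uminus ` closure S" for S :: "complex set"
      using closure_injective_linear_image[of uminus S] by (simp add: linear_uminus)
    have "julia c = uminus ` closure (filled_julia c) \<inter> uminus ` closure (- filled_julia c)"
      unfolding julia_def frontier_closures by (metis cl neg)
    also have "\<dots> = uminus ` julia c"
      unfolding julia_def frontier_closures by (simp add: image_Int)
    finally show ?thesis using that by blast
  qed
  from this[of z] this[of "-z"] show ?thesis by auto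
qed

text \<open>
  With a continuous square root \<open>h(z)\<close> of \<open>z - c\<close>, every \<open>w\<close> in the Julia set is \<open>h (Q c w)\<close> or
  \<open>- h (Q c w)\<close>. The sign is continuous in \<open>w\<close> and odd, so it takes both values,
  which is impossible on a connected set.
\<close>

theorem critical_point_in_filled_julia_if_mandelbrot:
  assumes "c \<in> mandelbrot"
  shows "0 \<in> filled_julia c"
proof (rule ccontr)
  assume zero: "0 \<notin> filled_julia c"
  hence "c \<notin> filled_julia c"
    using Q_in_filled_julia_iff[of c 0] by (simp add: Q_def)
  then obtain h where h: "continuous_on (filled_julia c) h"
    "\<And>z. z \<in> filled_julia c \<Longrightarrow> h z ^ 2 = z - c"
    using continuous_sqrt_on_filled_julia by blast
  define f where "f w = w / h (Q c w)" for w
  have JK: "julia c \<subseteq> filled_julia c"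
    unfolding julia_def by (intro frontier_subset_closed compact_imp_closed compact_filled_julia)
  have f_sq: "f w ^ 2 = 1" and h_nz: "h (Q c w) \<noteq> 0" if w: "w \<in> julia c" for w
  proof -
    have "w \<in> filled_julia c" using w JK by blast
    hence "h (Q c w) ^ 2 = w ^ 2" "w \<noteq> 0"
      using h(2)[of "Q c w"] zero Q_in_filled_julia_iff[of c w] by (auto simp: Q_def)
    thus "f w ^ 2 = 1" "h (Q c w) \<noteq> 0"
      by (auto simp: f_def power_divide)
  qed
  have "continuous_on (julia c) (h \<circ> Q c)"
  proof (rule continuous_on_compose)
    show "continuous_on (julia c) (Q c)"
      unfolding Q_def by (intro continuous_intros)
    show "continuous_on (Q c ` julia c) h"
      using JK by (intro continuous_on_subset[OF h(1)]) auto
  qed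
  hence "continuous_on (julia c) f"
    unfolding f_def using h_nz by (intro continuous_intros) (auto simp: o_def)
  moreover have "finite (f ` julia c)"
  proof (rule finite_subset)
    show "f ` julia c \<subseteq> {1, -1}"
      using f_sq by (auto simp: power2_eq_1_iff)
  qed auto
  moreover have "connected (julia c)"
    using assms by (simp add: mandelbrot_def)
  ultimately have const: "f constant_on julia c"
    by (intro continuous_finite_range_constant)
  have "julia c \<noteq> {}"
    unfolding julia_def
    using frontier_eq_empty filled_julia_nonempty compact_filled_julia
    by (metis compact_imp_bounded not_bounded_UNIV)
  then obtain w where w: "w \<in> julia c" by blast
  have "f (- w) = f w"
    using const w minus_in_julia_iff unfolding constant_on_def by metis
  moreover have "f (- w) = - f w" by (simp add: f_def)
  ultimately have "f w = 0" by simp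
  with f_sq[OF w] show False by simp
qed

corollary mandelbrot_iff: "c \<in> mandelbrot \<longleftrightarrow> (\<forall>n. cmod ((Q c ^^ n) 0) \<le> escape_radius c)"
  using critical_point_in_filled_julia_if_mandelbrot mandelbrot_if_critical_point_in_filled_julia
  by (auto simp flip: filled_julia_iff)

subsection \<open>The Mandelbrot set\<close>

lemma mandelbrot_subset_cball: "mandelbrot \<subseteq> cball 0 2"
proof
  fix c assume "c \<in> mandelbrot"
  hence M: "cmod ((Q c ^^ n) 0) \<le> escape_radius c" for n
    by (simp add: mandelbrot_iff)
  have False if c: "cmod c > 2"
  proof -
    have grow: "cmod ((Q c ^^ Suc n) 0) \<ge> cmod c * (cmod c - 1) ^ n" for n
    proof (induction n)
      case (Suc n)
      let ?z = "(Q c ^^ Suc n) 0"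
      have "cmod c * 1 \<le> cmod c * (cmod c - 1) ^ n"
        using c by (intro mult_left_mono one_le_power) auto
      hence z: "cmod ?z \<ge> cmod c" using Suc by linarith
      have "cmod c * (cmod c - 1) ^ Suc n \<le> cmod ?z * (cmod c - 1)"
        using mult_right_mono[OF Suc, of "cmod c - 1"] c by (simp add: mult_ac)
      also have "\<dots> \<le> cmod ?z * cmod ?z - cmod c"
        using mult_left_mono[OF z, of "cmod ?z"] z by (simp add: algebra_simps)
      also have "\<dots> = cmod (?z ^ 2) - cmod c" by (simp only: norm_mult power2_eq_square)
      also have "\<dots> \<le> cmod (Q c ?z)"
        unfolding Q_def[of c ?z] by (metis diff_minus_eq_add norm_minus_cancel norm_triangle_ineq2)
      finally show ?case by simp
    qed (simp add: Q_def)
    obtain n where n: "escape_radius c < (cmod c - 1) ^ n"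
      using real_arch_pow[of "cmod c - 1"] c by auto
    have "1 * (cmod c - 1) ^ n \<le> cmod c * (cmod c - 1) ^ n"
      using c by (intro mult_right_mono) auto
    with n grow[of n] M[of "Suc n"] show False by linarith
  qed
  thus "c \<in> cball 0 2" by (force simp: not_less)
qed

text \<open>
  Inside the Mandelbrot set the maps \<open>c \<mapsto> (Q c ^^ n) 0\<close> are uniformly bounded holomorphic
  functions, so Cauchy's estimate makes them uniformly Lipschitz.
\<close>

lemma critical_orbit_lipschitz_in_interior_mandelbrot:
  assumes "c \<in> interior mandelbrot"
  obtains r B where "r > 0" "B > 0"
    "\<And>n c'. dist c c' < r \<Longrightarrow> cmod ((Q c' ^^ n) 0 - (Q c ^^ n) 0) \<le> B * dist c c'"
proof -
  obtain e where e: "e > 0" "cball c e \<subseteq> mandelbrot"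
    using assms mem_interior_cball by blast
  define r where "r = e / 2"
  define R :: real where "R = 4"
  have r: "r > 0" using e by (simp add: r_def)
  have bound: "cmod ((Q z ^^ n) 0) \<le> R" if "z \<in> cball c e" for z n
  proof -
    have "z \<in> mandelbrot" using that e by blast
    moreover have "cmod z \<le> 2"
      using \<open>z \<in> mandelbrot\<close> mandelbrot_subset_cball by auto
    ultimately have "cmod ((Q z ^^ n) 0) \<le> cmod z + 2"
      using mandelbrot_iff[of z] by (simp add: escape_radius_def)
    with \<open>cmod z \<le> 2\<close> show ?thesis by (simp add: R_def)
  qed
  have "cmod ((Q c' ^^ n) 0 - (Q c ^^ n) 0) \<le> R / r * dist c c'" if c': "dist c c' < r" for n c'
  proof -
    define f where "f z = (Q z ^^ n) 0" for z
    have hol: "f holomorphic_on S" for S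
      unfolding f_def by (rule holomorphic_on_critical_orbit)
    have "cmod (f c' - f c) \<le> R / r * cmod (c' - c)"
    proof (rule field_differentiable_bound[of "ball c r" f "deriv f"])
      show "(f has_field_derivative deriv f z) (at z within ball c r)" for z
        using hol[of UNIV] holomorphic_derivI[OF hol[of UNIV] open_UNIV]
        by (blast intro: has_field_derivative_at_within)
      show "cmod (deriv f z) \<le> R / r" if "z \<in> ball c r" for z
      proof -
        have "cmod ((deriv ^^ 1) f z) \<le> fact 1 * R / r ^ 1"
        proof (rule Cauchy_inequality)
          show "continuous_on (cball z r) f"
            using hol holomorphic_on_imp_continuous_on by blast
          show "cmod (f x) \<le> R" if "cmod (z - x) = r" for x
          proof -
            have "dist c x \<le> dist c z + dist z x" by (rule dist_triangle)
            also have "\<dots> \<le> e" using that \<open>z \<in> ball c r\<close> by (simp add: dist_norm r_def)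
            finally show ?thesis unfolding f_def by (intro bound) simp
          qed
        qed (use r hol in auto)
        thus ?thesis by simp
      qed
    qed (use r c' in auto)
    thus ?thesis by (simp add: f_def dist_norm norm_minus_commute)
  qed
  moreover have "R / r > 0" using r by (simp add: R_def)
  ultimately show ?thesis using r that by blast
qed


section \<open>Real critical orbits near the parameter -2\<close>

primrec crit_orbit :: "real \<Rightarrow> nat \<Rightarrow> real" where
  "crit_orbit c 0 = 0"
| "crit_orbit c (Suc n) = (crit_orbit c n)\<^sup>2 + c"

lemma Q_iterate_of_real: "(Q (of_real c) ^^ n) 0 = of_real (crit_orbit c n)"
  by (induction n) (auto simp: Q_def)

lemma continuous_on_crit_orbit [continuous_intros]: "continuous_on S (\<lambda>c. crit_orbit c n)"
  by (induction n) (auto intro!: continuous_intros)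

lemma crit_orbit_minus_2: "n \<ge> 2 \<Longrightarrow> crit_orbit (-2) n = 2"
  by (induction n rule: dec_induct) (simp_all add: numeral_2_eq_2)

text \<open>The interval between the first two critical orbit points is invariant.\<close>

lemma crit_orbit_bounds:
  assumes "-2 \<le> c" "c \<le> 0"
  shows "c \<le> crit_orbit c (Suc n) \<and> crit_orbit c (Suc n) \<le> c\<^sup>2 + c"
proof (induction n)
  case 0
  show ?case by simp
next
  case (Suc n)
  have "c * (c + 2) \<le> 0" using assms by (simp add: mult_nonpos_nonneg)
  hence "\<bar>crit_orbit c (Suc n)\<bar> \<le> \<bar>c\<bar>"
    using Suc assms by (simp add: power2_eq_square algebra_simps abs_le_iff)
  hence "(crit_orbit c (Suc n))\<^sup>2 \<le> c\<^sup>2" by (simp add: abs_le_square_iff)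
  thus ?case by simp
qed

lemma abs_crit_orbit_le_2:
  assumes "-2 \<le> c" "c \<le> 0"
  shows "\<bar>crit_orbit c n\<bar> \<le> 2"
proof (cases n)
  case (Suc m)
  have "c * (c + 2) \<le> 0" using assms by (simp add: mult_nonpos_nonneg)
  thus ?thesis
    using crit_orbit_bounds[OF assms, of m] assms
    unfolding Suc abs_le_iff by (simp add: power2_eq_square algebra_simps del: crit_orbit.simps)
qed simp

lemma crit_orbit_lipschitz:
  assumes "-2 \<le> c" "c \<le> 0" "-2 \<le> c'" "c' \<le> 0"
  shows "\<bar>crit_orbit c n - crit_orbit c' n\<bar> \<le> 5 ^ n * \<bar>c - c'\<bar>"
proof (induction n)
  case (Suc n)
  let ?x = "crit_orbit c n" and ?y = "crit_orbit c' n"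
  have xy: "\<bar>?x + ?y\<bar> \<le> 4"
    using abs_crit_orbit_le_2[OF assms(1,2), of n] abs_crit_orbit_le_2[OF assms(3,4), of n] by linarith
  have "crit_orbit c (Suc n) - crit_orbit c' (Suc n) = (?x + ?y) * (?x - ?y) + (c - c')"
    by (simp add: power2_eq_square algebra_simps)
  hence "\<bar>crit_orbit c (Suc n) - crit_orbit c' (Suc n)\<bar> \<le> \<bar>?x + ?y\<bar> * \<bar>?x - ?y\<bar> + \<bar>c - c'\<bar>"
    by (metis abs_mult abs_triangle_ineq)
  also have "\<dots> \<le> 4 * (5 ^ n * \<bar>c - c'\<bar>) + 1 * \<bar>c - c'\<bar>"
    using xy Suc by (intro add_mono mult_mono) auto
  also have "\<dots> \<le> 4 * (5 ^ n * \<bar>c - c'\<bar>) + 5 ^ n * \<bar>c - c'\<bar>"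
    by (intro add_left_mono mult_right_mono) auto
  finally show ?case by (simp del: crit_orbit.simps add: mult_ac)
qed simp

text \<open>
  For \<open>c\<close> slightly above \<open>-2\<close> the second critical orbit point lies just below \<open>2\<close>. As long as the
  orbit stays positive, its distance from \<open>2\<close> grows at least by the factor \<open>3/2\<close> in each step,
  so it cannot stay positive. Since it does for \<open>c = -2\<close>, the intermediate value theorem gives
  parameters near \<open>-2\<close> with periodic critical point.
\<close>

lemma superstable_parameter_near_minus_2:
  assumes "0 < \<eta>" "\<eta> \<le> 1/2"
  obtains c n where "-2 \<le> c" "c \<le> -2 + \<eta>" "n \<ge> 2" "crit_orbit c n = 0"
proof -
  define c where "c = -2 + \<eta>"
  have "\<exists>n\<ge>2. crit_orbit c n \<le> 0"
  proof (rule ccontr)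
    assume "\<not> ?thesis"
    hence pos: "crit_orbit c n > 0" if "n \<ge> 2" for n using that by force
    define e where "e n = 2 - crit_orbit c (n + 2)" for n
    have e_less: "e n < 2" for n using pos[of "n + 2"] by (simp add: e_def)
    have e_Suc: "e (Suc n) = 4 * e n - e n * e n - \<eta>" for n
      by (simp add: e_def c_def power2_eq_square algebra_simps)
    have grow: "e n \<ge> 2 * \<eta> * (3/2) ^ n" for n
    proof (induction n)
      case 0
      have "\<eta> * \<eta> \<le> \<eta> * 1" using assms by (intro mult_left_mono) auto
      thus ?case by (simp add: e_def c_def numeral_2_eq_2 power2_eq_square algebra_simps)
    next
      case (Suc n)
      have "2 * \<eta> * 1 \<le> 2 * \<eta> * (3/2) ^ n"
        using assms by (intro mult_left_mono one_le_power) auto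
      hence en: "e n \<ge> 2 * \<eta>" using Suc by linarith
      have "e n * e n \<le> 2 * e n"
        using e_less[of n] en assms by (intro mult_right_mono) auto
      hence "e (Suc n) \<ge> (3/2) * e n" unfolding e_Suc using en by linarith
      thus ?case using Suc by simp
    qed
    obtain n where "1 / \<eta> < (3/2 :: real) ^ n" using real_arch_pow[of "3/2"] by auto
    hence "1 < \<eta> * (3/2) ^ n" using assms by (simp add: field_simps)
    with grow[of n] e_less[of n] show False by linarith
  qed
  then obtain n where n: "n \<ge> 2" "crit_orbit c n \<le> 0" by blast
  have "\<exists>x\<ge>-2. x \<le> c \<and> crit_orbit x n = 0"
    using n crit_orbit_minus_2[of n] assms
    by (intro IVT2') (auto simp: c_def intro: continuous_intros)
  thus ?thesis using that n(1) c_def by blast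
qed

subsection \<open>Realising sign patterns\<close>

text \<open>
  \<open>radical_bound r = 2 * cos (pi / 2^(r + 1))\<close> bounds the nested radical
  \<open>sqrt (2 + sqrt (2 + ...))\<close> with \<open>r\<close> roots.
\<close>

primrec radical_bound :: "nat \<Rightarrow> real" where
  "radical_bound 0 = 0"
| "radical_bound (Suc r) = sqrt (2 + radical_bound r)"

lemma radical_bound_range: "0 \<le> radical_bound r \<and> radical_bound r < 2"
  by (induction r) (auto intro: real_less_lsqrt)

lemma radical_bound_mono: "r \<le> r' \<Longrightarrow> radical_bound r \<le> radical_bound r'"
proof (induction r' rule: dec_induct)
  case (step n)
  have "radical_bound n \<le> radical_bound (Suc n)" by (induction n) (auto simp: radical_bound_range)
  with step show ?case by linarith
qed simp

definition frequently_negative :: "nat \<Rightarrow> (nat \<Rightarrow> real) \<Rightarrow> bool" where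
  "frequently_negative k \<sigma> \<longleftrightarrow> (\<forall>j. \<sigma> j \<in> {-1, 1}) \<and> (\<forall>j. \<exists>i<k. \<sigma> (j + i) = -1)"

text \<open>
  \<open>nested_radical c \<sigma> n j\<close> is the point that \<open>n\<close> steps of \<open>z^2 + c\<close> take to \<open>0\<close> along the signs
  \<open>\<sigma> j, \<dots>, \<sigma> (j + n - 1)\<close>.
\<close>

primrec nested_radical :: "real \<Rightarrow> (nat \<Rightarrow> real) \<Rightarrow> nat \<Rightarrow> nat \<Rightarrow> real" where
  "nested_radical c \<sigma> 0 j = 0"
| "nested_radical c \<sigma> (Suc n) j = \<sigma> j * sqrt (nested_radical c \<sigma> n (Suc j) - c)"

lemma continuous_on_nested_radical [continuous_intros]:
  "continuous_on S (\<lambda>c. nested_radical c \<sigma> n j)"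
  by (induction n arbitrary: j) (auto intro!: continuous_intros)

text \<open>
  After a negative sign the point is at most \<open>0\<close>, so its preimages are bounded by
  \<open>sqrt 2\<close>, theirs by \<open>sqrt (2 + sqrt 2)\<close>, and so on. If negative signs recur within \<open>k\<close>
  steps, all points stay in \<open>[- radical_bound k, radical_bound k]\<close>, which lies to the right of
  the critical value, so the roots stay real.
\<close>

lemma nested_radical_bounds:
  assumes \<sigma>: "frequently_negative k \<sigma>" and c: "-2 \<le> c" "c \<le> - radical_bound k"
  shows "\<bar>nested_radical c \<sigma> n j\<bar> \<le> radical_bound k"
proof -
  have abs_\<sigma>: "\<bar>\<sigma> j\<bar> = 1" for j
    using \<sigma> unfolding frequently_negative_def by (metis abs_minus_cancel abs_one empty_iff insertE)
  have "(\<forall>j. \<bar>nested_radical c \<sigma> n j\<bar> \<le> radical_bound k) \<and>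
        (\<forall>j i. \<sigma> (j + i) = -1 \<longrightarrow> nested_radical c \<sigma> n j \<le> radical_bound i)"
  proof (induction n)
    case 0
    show ?case by (simp add: radical_bound_range)
  next
    case (Suc n)
    have pos: "nested_radical c \<sigma> n (Suc j) - c \<ge> 0" for j
      using Suc c by (smt (verit))
    have upper: "\<bar>nested_radical c \<sigma> (Suc n) j\<bar> \<le> radical_bound (Suc i)" if "\<sigma> (Suc j + i) = -1" for i j
    proof -
      have "nested_radical c \<sigma> n (Suc j) \<le> radical_bound i"
        using Suc that by blast
      hence "sqrt (nested_radical c \<sigma> n (Suc j) - c) \<le> radical_bound (Suc i)"
        using c by simp
      thus ?thesis using pos[of j] by (simp add: abs_mult abs_\<sigma>)
    qed
    show ?case
    proof (intro conjI allI impI)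
      fix j
      obtain i where i: "i < k" "\<sigma> (Suc j + i) = -1"
        using \<sigma> unfolding frequently_negative_def by blast
      show "\<bar>nested_radical c \<sigma> (Suc n) j\<bar> \<le> radical_bound k"
        using upper[OF i(2)] radical_bound_mono[of "Suc i" k] i(1) by linarith
    next
      fix j i assume i: "\<sigma> (j + i) = -1"
      show "nested_radical c \<sigma> (Suc n) j \<le> radical_bound i"
      proof (cases i)
        case 0
        thus ?thesis using i pos[of j] by simp
      next
        case (Suc i')
        with i have "\<sigma> (Suc j + i') = -1" by simp
        from upper[OF this] show ?thesis unfolding Suc by linarith
      qed
    qed
  qed
  thus ?thesis by blast
qed

text \<open>
  Let \<open>c1\<close> be a parameter whose critical orbit returns to \<open>0\<close> at time \<open>N - 1\<close>. As \<open>c\<close> runs from \<open>-2\<close> to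
  \<open>c1\<close>, the \<open>N\<close>-th critical orbit point runs from \<open>2\<close> down to \<open>c1\<close>, and so meets each of the
  continuously moving points \<open>nested_radical c \<sigma> n 0\<close>. Compactness yields infinite patterns.
\<close>

lemma sign_pattern_realised:
  assumes \<eta>: "0 < \<eta>" "\<eta> \<le> 1/2" "\<eta> \<le> (2 - radical_bound k) / 2"
  obtains N where "\<And>\<sigma>. frequently_negative k \<sigma> \<Longrightarrow>
    \<exists>c\<in>{-2..-2 + \<eta>}. \<forall>j. \<sigma> j * crit_orbit c (N + j) \<in> {sqrt ((2 - radical_bound k) / 2)..radical_bound k}"
proof -
  define a where "a = radical_bound k"
  define d where "d = sqrt ((2 - a) / 2)"
  obtain c1 m where c1: "-2 \<le> c1" "c1 \<le> -2 + \<eta>" "m \<ge> 2" "crit_orbit c1 m = 0"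
    using superstable_parameter_near_minus_2[OF \<eta>(1,2)] by blast
  define N where "N = Suc m"
  have a: "0 \<le> a" "a < 2" using radical_bound_range by (auto simp: a_def)
  have "\<exists>c\<in>{-2..-2 + \<eta>}. \<forall>j. \<sigma> j * crit_orbit c (N + j) \<in> {d..a}" if \<sigma>: "frequently_negative k \<sigma>" for \<sigma>
  proof -
    have abs_\<sigma>: "\<bar>\<sigma> j\<bar> = 1" for j
      using \<sigma> unfolding frequently_negative_def by (metis abs_minus_cancel abs_one empty_iff insertE)
    have \<sigma>_sq: "\<sigma> j * \<sigma> j = 1" for j using abs_\<sigma>[of j] by (metis abs_mult_self_eq mult_1)
    have \<sigma>_sq': "(\<sigma> j)\<^sup>2 = 1" for j using \<sigma>_sq[of j] by (simp add: power2_eq_square)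
    define F where "F n = {c \<in> {-2..-2 + \<eta>}. \<forall>j<n. \<sigma> j * crit_orbit c (N + j) \<in> {d..a}}" for n
    have "F n \<noteq> {}" for n
    proof -
      have bd: "\<bar>nested_radical c \<sigma> n' j\<bar> \<le> a" if "-2 \<le> c" "c \<le> c1" for c n' j
        unfolding a_def using that c1 \<eta> a by (intro nested_radical_bounds[OF \<sigma>]) (auto simp: a_def)
      have "\<exists>c\<ge>-2. c \<le> c1 \<and> crit_orbit c N - nested_radical c \<sigma> n 0 = 0"
      proof (rule IVT2')
        show "crit_orbit c1 N - nested_radical c1 \<sigma> n 0 \<le> 0"
          using bd[of c1 n 0] c1 \<eta> a by (simp add: N_def a_def abs_le_iff)
        show "0 \<le> crit_orbit (- 2) N - nested_radical (- 2) \<sigma> n 0"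
          using bd[of "-2" n 0] c1 a crit_orbit_minus_2[of N] by (simp add: N_def abs_le_iff)
      qed (use c1 in \<open>auto intro!: continuous_intros\<close>)
      then obtain c where c: "-2 \<le> c" "c \<le> c1" "crit_orbit c N = nested_radical c \<sigma> n 0" by auto
      have pos: "nested_radical c \<sigma> n' j - c \<ge> (2 - a) / 2" for n' j
        using bd[OF c(1,2), of n' j] c c1 \<eta> unfolding a_def[symmetric] abs_le_iff by argo
      have orbit: "crit_orbit c (N + j) = nested_radical c \<sigma> (n - j) j" if "j \<le> n" for j
        using that
      proof (induction j)
        case (Suc j)
        have "n - j = Suc (n - Suc j)" using Suc by simp
        moreover have "nested_radical c \<sigma> (n - Suc j) (Suc j) - c \<ge> 0"
          using order_trans[OF _ pos, of 0] a by simp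
        ultimately show ?case using Suc by (simp add: power_mult_distrib \<sigma>_sq')
      qed (use c in simp)
      have "\<sigma> j * crit_orbit c (N + j) \<in> {d..a}" if j: "j < n" for j
      proof -
        define r where "r = nested_radical c \<sigma> (n - Suc j) (Suc j) - c"
        have "n - j = Suc (n - Suc j)" using j by simp
        hence eq: "crit_orbit c (N + j) = \<sigma> j * sqrt r"
          using orbit[of j] j by (simp add: r_def)
        have "r \<ge> (2 - a) / 2" unfolding r_def by (rule pos)
        hence "sqrt r \<ge> d" by (simp add: d_def)
        moreover have "sqrt r \<le> a"
        proof -
          have "\<bar>\<sigma> j * sqrt r\<bar> \<le> a"
            using orbit[of j] j bd[OF c(1,2), of "n - j" j] eq by simp
          thus ?thesis by (simp add: abs_mult abs_\<sigma>)
        qed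
        moreover have "\<sigma> j * crit_orbit c (N + j) = sqrt r"
          unfolding eq by (simp add: \<sigma>_sq flip: mult.assoc)
        ultimately show ?thesis by simp
      qed
      hence "c \<in> F n" using c c1 by (simp add: F_def)
      thus ?thesis by blast
    qed
    moreover have "compact (F n)" for n
    proof -
      have "F n = {-2..-2 + \<eta>} \<inter> (\<Inter>j\<in>{..<n}. (\<lambda>c. \<sigma> j * crit_orbit c (N + j)) -` {d..a})"
        by (auto simp: F_def)
      moreover have "closed (\<Inter>j\<in>{..<n}. (\<lambda>c. \<sigma> j * crit_orbit c (N + j)) -` {d..a})"
        by (intro closed_INT ballI closed_vimage) (auto intro!: continuous_intros)
      ultimately show ?thesis by (simp add: compact_Int_closed)
    qed
    moreover have "F n \<subseteq> F m" if "m \<le> n" for m n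
      using that by (auto simp: F_def)
    ultimately have "\<Inter> (range F) \<noteq> {}" by (intro compact_nest)
    then obtain c where c: "c \<in> F n" for n by blast
    have "\<sigma> j * crit_orbit c (N + j) \<in> {d..a}" for j
      using c[of "Suc j"] by (auto simp: F_def)
    moreover have "c \<in> {-2..-2 + \<eta>}" using c[of 0] by (simp add: F_def)
    ultimately show ?thesis by blast
  qed
  thus ?thesis using that unfolding a_def d_def by blast
qed

subsection \<open>Separation of parameters\<close>

text \<open>
  Under \<open>x = 2 cos \<phi>\<close> the map \<open>x^2 - 2\<close> becomes \<open>\<phi> \<mapsto> 2 \<phi>\<close>, so in the metric with density
  \<open>1 / sqrt (4 - x^2)\<close> it expands by exactly \<open>2\<close>. Away from \<open>0\<close> and \<open>\<plusminus>2\<close> this survives small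
  changes of the parameter and of the derivative up to an arbitrarily small factor.
\<close>

lemma almost_doubling_metric:
  fixes \<Lambda> d b :: real
  assumes \<Lambda>: "\<Lambda> > 2" and d: "0 < d" and b: "b < 2"
  obtains h \<eta> where "h > 0" "\<eta> > 0"
    "\<And>c x. -2 \<le> c \<Longrightarrow> c \<le> -2 + \<eta> \<Longrightarrow> d \<le> \<bar>x\<bar> \<Longrightarrow> \<bar>x\<bar> \<le> b \<Longrightarrow>
        (2 * \<bar>x\<bar> + h) * sqrt (4 - x\<^sup>2) \<le> \<Lambda> * sqrt (4 - (x\<^sup>2 + c)\<^sup>2)"
proof -
  define l where "l = \<Lambda> / 2"
  have l: "l > 1" using \<Lambda> by (simp add: l_def)
  define h where "h = 2 * d * (sqrt l - 1)"
  define \<mu> where "\<mu> = d\<^sup>2 * (4 - b\<^sup>2)"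
  \<comment> \<open>for \<open>d > b\<close> the estimate concerns no point at all, and \<open>\<mu>\<close> need not be positive\<close>
  define \<eta> where "\<eta> = (if d \<le> b then min 1 ((l - 1) * \<mu> / (5 * l)) else 1)"
  have h: "h > 0" using l d by (simp add: h_def)
  have \<mu>: "\<mu> > 0" if "d \<le> b"
  proof -
    have "b\<^sup>2 < 2\<^sup>2" using that d b by (intro power_strict_mono) auto
    thus ?thesis using d by (simp add: \<mu>_def)
  qed
  have \<eta>: "\<eta> > 0" using \<mu> l by (simp add: \<eta>_def)
  have "(2 * \<bar>x\<bar> + h) * sqrt (4 - x\<^sup>2) \<le> \<Lambda> * sqrt (4 - (x\<^sup>2 + c)\<^sup>2)"
    if c: "-2 \<le> c" "c \<le> -2 + \<eta>" and x: "d \<le> \<bar>x\<bar>" "\<bar>x\<bar> \<le> b" for c x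
  proof -
    define t where "t = c + 2"
    have t: "0 \<le> t" "t \<le> 1" "5 * l * t \<le> (l - 1) * \<mu>"
      using c x l by (auto simp: t_def \<eta>_def field_simps)
    have x2: "d\<^sup>2 \<le> x\<^sup>2" "x\<^sup>2 \<le> b\<^sup>2" "b\<^sup>2 \<le> 4"
      using x d b power_mono[of d "\<bar>x\<bar>" 2] power_mono[of "\<bar>x\<bar>" b 2] power_mono[of b 2 2] by auto
    define P where "P = x\<^sup>2 * (4 - x\<^sup>2)"
    have P: "\<mu> \<le> P" unfolding P_def \<mu>_def using x2 by (intro mult_mono) auto
    have "t * x\<^sup>2 \<le> t * 4" "t * t \<le> t * 1"
      using x2 t by (intro mult_left_mono; simp)+
    hence "4 - (x\<^sup>2 + c)\<^sup>2 \<ge> P - 5 * t"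
      using t by (simp add: P_def t_def power2_eq_square algebra_simps)
    hence "l * (4 - (x\<^sup>2 + c)\<^sup>2) \<ge> l * (P - 5 * t)"
      using l by (intro mult_left_mono) auto
    moreover have "(l - 1) * \<mu> \<le> (l - 1) * P" using l P by (intro mult_left_mono) auto
    ultimately have key: "P \<le> l * (4 - (x\<^sup>2 + c)\<^sup>2)"
      using t(3) by (simp add: algebra_simps)
    have "d * (sqrt l - 1) \<le> \<bar>x\<bar> * (sqrt l - 1)"
      using x l by (intro mult_right_mono) auto
    hence "2 * \<bar>x\<bar> + h \<le> 2 * sqrt l * \<bar>x\<bar>"
      by (simp add: h_def algebra_simps)
    hence "(2 * \<bar>x\<bar> + h) * sqrt (4 - x\<^sup>2) \<le> 2 * sqrt l * \<bar>x\<bar> * sqrt (4 - x\<^sup>2)"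
      using x2 by (intro mult_right_mono) auto
    also have "\<dots> = 2 * sqrt l * sqrt P"
      by (simp add: P_def real_sqrt_mult)
    also have "\<dots> \<le> 2 * sqrt l * sqrt (l * (4 - (x\<^sup>2 + c)\<^sup>2))"
      using key l by (intro mult_left_mono real_sqrt_le_mono) auto
    also have "\<dots> = \<Lambda> * sqrt (4 - (x\<^sup>2 + c)\<^sup>2)"
    proof -
      have "2 * (sqrt l * sqrt l) = \<Lambda>" using l by (simp add: l_def)
      moreover have "2 * sqrt l * (sqrt l * s) = 2 * (sqrt l * sqrt l) * s" for s
        by simp
      ultimately show ?thesis by (simp only: real_sqrt_mult)
    qed
    finally show ?thesis .
  qed
  thus ?thesis using that h \<eta> by blast
qed

text \<open>
  Orbits that become \<open>2 d\<close> apart at time \<open>N + n\<close> are \<open>min h (2 d)\<close> apart for the first time at some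
  \<open>N + m\<close> with \<open>m \<le> n\<close>. Up to then \<open>2 \<bar>x\<bar> + h\<close> bounds the factor \<open>\<bar>x + y\<bar>\<close> by which a
  difference \<open>x - y\<close> of orbit points is stretched, so in the metric above the difference grows at
  most by the factor \<open>\<Lambda>\<close> per step. Reaching a definite size takes an initial difference of at
  least a constant times \<open>\<Lambda>^(-n)\<close>.
\<close>

lemma orbit_separation_bound:
  fixes \<Lambda> d b :: real
  assumes \<Lambda>: "\<Lambda> > 2" and d: "0 < d" and b: "b < 2"
  obtains \<eta> where "\<eta> > 0"
    "\<And>N. \<exists>C>0. \<forall>c\<in>{-2..-2 + \<eta>}. \<forall>c'\<in>{-2..-2 + \<eta>}. \<forall>n.
       (\<forall>j. d \<le> \<bar>crit_orbit c (N + j)\<bar> \<and> \<bar>crit_orbit c (N + j)\<bar> \<le> b) \<longrightarrow>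
       2 * d \<le> \<bar>crit_orbit c (N + n) - crit_orbit c' (N + n)\<bar> \<longrightarrow> 1 \<le> C * \<Lambda> ^ n * \<bar>c - c'\<bar>"
proof -
  obtain h0 \<eta>0 where h0: "h0 > 0" and \<eta>0: "\<eta>0 > 0" and metric:
    "\<And>c x. -2 \<le> c \<Longrightarrow> c \<le> -2 + \<eta>0 \<Longrightarrow> d \<le> \<bar>x\<bar> \<Longrightarrow> \<bar>x\<bar> \<le> b \<Longrightarrow>
        (2 * \<bar>x\<bar> + h0) * sqrt (4 - x\<^sup>2) \<le> \<Lambda> * sqrt (4 - (x\<^sup>2 + c)\<^sup>2)"
    using almost_doubling_metric[OF \<Lambda> d b] by blast
  define h where "h = min h0 (2 * d)"
  define \<eta> where "\<eta> = min \<eta>0 2"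
  define W where "W = 1 / sqrt (4 - b\<^sup>2)"
  have h: "h > 0" using h0 d by (simp add: h_def)
  have \<eta>: "\<eta> > 0" using \<eta>0 by (simp add: \<eta>_def)
  have "\<exists>C>0. \<forall>c\<in>{-2..-2 + \<eta>}. \<forall>c'\<in>{-2..-2 + \<eta>}. \<forall>n.
       (\<forall>j. d \<le> \<bar>crit_orbit c (N + j)\<bar> \<and> \<bar>crit_orbit c (N + j)\<bar> \<le> b) \<longrightarrow>
       2 * d \<le> \<bar>crit_orbit c (N + n) - crit_orbit c' (N + n)\<bar> \<longrightarrow> 1 \<le> C * \<Lambda> ^ n * \<bar>c - c'\<bar>" for N
  proof (cases "d \<le> b")
    case False
    thus ?thesis by (intro exI[of _ 1]) force
  next
    case True
    have b2: "b\<^sup>2 < 4" using True d b power_strict_mono[of b 2 2] by simp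
    hence W: "W > 0" by (simp add: W_def)
    define C where "C = 2 * W * (5 ^ N + 1) / h"
    have C: "C > 0" using W h by (simp add: C_def add_pos_pos)
    have "1 \<le> C * \<Lambda> ^ n * \<bar>c - c'\<bar>"
      if c: "c \<in> {-2..-2 + \<eta>}" "c' \<in> {-2..-2 + \<eta>}"
        and orbit: "\<And>j. d \<le> \<bar>crit_orbit c (N + j)\<bar> \<and> \<bar>crit_orbit c (N + j)\<bar> \<le> b"
        and sep: "2 * d \<le> \<bar>crit_orbit c (N + n) - crit_orbit c' (N + n)\<bar>" for c c' n
    proof -
      define x where "x j = crit_orbit c (N + j)" for j
      define D where "D j = \<bar>x j - crit_orbit c' (N + j)\<bar>" for j
      define w where "w j = 1 / sqrt (4 - (x j)\<^sup>2)" for j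
      define e where "e = \<bar>c - c'\<bar>"
      have cc: "-2 \<le> c" "c \<le> 0" "c \<le> -2 + \<eta>0" "-2 \<le> c'" "c' \<le> 0" using c by (auto simp: \<eta>_def)
      have xj: "d \<le> \<bar>x j\<bar>" "\<bar>x j\<bar> \<le> b" for j using orbit by (auto simp: x_def)
      have x2: "(x j)\<^sup>2 \<le> b\<^sup>2" for j using power_mono[OF xj(2)[of j], of 2] by simp
      have w_pos: "w j > 0" for j using x2[of j] b2 by (simp add: w_def)
      have w_le: "w j \<le> W" for j
        unfolding w_def W_def using x2[of j] b2 by (intro divide_left_mono) auto
      have w_ge: "1 \<le> 2 * w j" for j
      proof -
        have "sqrt (4 - (x j)\<^sup>2) \<le> sqrt 4" by (intro real_sqrt_le_mono) simp
        thus ?thesis using x2[of j] b2 by (simp add: w_def field_simps)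
      qed
      have stretch: "(2 * \<bar>x j\<bar> + h) * w (Suc j) \<le> \<Lambda> * w j" for j
      proof -
        have "(2 * \<bar>x j\<bar> + h0) * sqrt (4 - (x j)\<^sup>2) \<le> \<Lambda> * sqrt (4 - (x (Suc j))\<^sup>2)"
          using metric[OF cc(1,3) xj(1,2)] by (simp add: x_def)
        moreover have "(2 * \<bar>x j\<bar> + h) * sqrt (4 - (x j)\<^sup>2) \<le> (2 * \<bar>x j\<bar> + h0) * sqrt (4 - (x j)\<^sup>2)"
          using x2[of j] b2 by (intro mult_right_mono) (auto simp: h_def)
        ultimately have "(2 * \<bar>x j\<bar> + h) * sqrt (4 - (x j)\<^sup>2) \<le> \<Lambda> * sqrt (4 - (x (Suc j))\<^sup>2)"
          by linarith
        moreover have "sqrt (4 - (x j)\<^sup>2) > 0" "sqrt (4 - (x (Suc j))\<^sup>2) > 0"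
          using x2[of j] x2[of "Suc j"] b2 by auto
        ultimately show ?thesis
          unfolding w_def by (simp add: divide_simps mult_ac)
      qed
      have "h \<le> D n" using sep by (auto simp: h_def D_def x_def)
      define m where "m = (LEAST i. h \<le> D i)"
      have m: "h \<le> D m" "m \<le> n"
        using \<open>h \<le> D n\<close> unfolding m_def by (auto intro: LeastI Least_le)
      have close: "D j < h" if "j < m" for j
        using not_less_Least[OF that[unfolded m_def]] by simp
      \<comment> \<open>the summand \<open>W * e\<close> absorbs the error \<open>\<bar>c - c'\<bar>\<close> that each step adds, as \<open>\<Lambda> \<ge> 2\<close>\<close>
      have growth: "D j * w j + W * e \<le> \<Lambda> ^ j * (W * (5 ^ N + 1) * e)" if "j \<le> m" for j
        using that
      proof (induction j)
        case 0
        have "D 0 * w 0 \<le> (5 ^ N * e) * W"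
          using crit_orbit_lipschitz[OF cc(1,2,4,5), of N] w_le[of 0] w_pos[of 0]
          by (intro mult_mono) (auto simp: D_def x_def e_def)
        thus ?case by (simp add: algebra_simps)
      next
        case (Suc j)
        let ?y = "crit_orbit c' (N + j)"
        have "x (Suc j) - crit_orbit c' (N + Suc j) = (x j + ?y) * (x j - ?y) + (c - c')"
          by (simp add: x_def power2_eq_square algebra_simps)
        hence "D (Suc j) \<le> \<bar>x j + ?y\<bar> * D j + e"
          unfolding D_def e_def by (metis abs_mult abs_triangle_ineq)
        also have "\<bar>x j + ?y\<bar> \<le> 2 * \<bar>x j\<bar> + h"
          using close[of j] Suc.prems unfolding D_def by linarith
        hence "\<bar>x j + ?y\<bar> * D j + e \<le> (2 * \<bar>x j\<bar> + h) * D j + e"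
          by (intro add_right_mono mult_right_mono) (auto simp: D_def)
        finally have "D (Suc j) * w (Suc j) \<le> ((2 * \<bar>x j\<bar> + h) * D j + e) * w (Suc j)"
          using w_pos[of "Suc j"] by (intro mult_right_mono) auto
        also have "\<dots> = ((2 * \<bar>x j\<bar> + h) * w (Suc j)) * D j + w (Suc j) * e"
          by (simp add: algebra_simps)
        also have "\<dots> \<le> (\<Lambda> * w j) * D j + W * e"
          using stretch[of j] w_le[of "Suc j"] by (intro add_mono mult_right_mono) (auto simp: D_def e_def)
        finally have "D (Suc j) * w (Suc j) + W * e \<le> \<Lambda> * w j * D j + 2 * (W * e)" by simp
        also have "2 * (W * e) \<le> \<Lambda> * (W * e)"
          using \<Lambda> W by (intro mult_right_mono) (auto simp: e_def)
        hence "\<Lambda> * w j * D j + 2 * (W * e) \<le> \<Lambda> * (D j * w j + W * e)"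
          by (simp add: algebra_simps)
        also have "\<dots> \<le> \<Lambda> * (\<Lambda> ^ j * (W * (5 ^ N + 1) * e))"
          using Suc \<Lambda> by (intro mult_left_mono) auto
        finally show ?case by (simp add: mult_ac)
      qed
      have K: "W * (5 ^ N + 1) * e \<ge> 0" using W by (auto simp: e_def intro!: mult_nonneg_nonneg add_nonneg_nonneg)
      have "h \<le> D m * (2 * w m)"
        using m(1) mult_left_mono[OF w_ge[of m], of "D m"] by (simp add: D_def)
      also have "\<dots> \<le> 2 * (D m * w m + W * e)"
        using W by (simp add: e_def)
      also have "\<dots> \<le> 2 * (\<Lambda> ^ m * (W * (5 ^ N + 1) * e))"
        using growth[of m] by simp
      also have "\<dots> \<le> 2 * (\<Lambda> ^ n * (W * (5 ^ N + 1) * e))"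
        using \<Lambda> m(2) K by (intro mult_left_mono mult_right_mono power_increasing) auto
      finally show ?thesis using h by (simp add: C_def e_def field_simps)
    qed
    thus ?thesis using C by blast
  qed
  thus ?thesis using that \<eta> by blast
qed


section \<open>Encoding binary digits in sign patterns\<close>

definition binary_digit :: "real \<Rightarrow> nat \<Rightarrow> bool" where
  "binary_digit \<theta> i \<longleftrightarrow> odd \<lfloor>2 ^ Suc i * \<theta>\<rfloor>"

lemma abs_diff_le_if_binary_digits_agree:
  assumes \<theta>: "\<theta> \<in> {0..<1}" "\<theta>' \<in> {0..<1}"
    and agree: "\<And>i. i < n \<Longrightarrow> binary_digit \<theta> i = binary_digit \<theta>' i"
  shows "\<bar>\<theta> - \<theta>'\<bar> \<le> 1 / 2 ^ n"
proof -
  have "\<lfloor>2 ^ n * \<theta>\<rfloor> = \<lfloor>2 ^ n * \<theta>'\<rfloor>"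
    using agree
  proof (induction n)
    case 0
    have "\<lfloor>\<theta>\<rfloor> = 0" "\<lfloor>\<theta>'\<rfloor> = 0" using \<theta> by (auto simp: floor_eq_iff)
    thus ?case by simp
  next
    case (Suc n)
    have split: "\<lfloor>2 ^ Suc n * x\<rfloor> = 2 * \<lfloor>2 ^ n * x\<rfloor> + (if odd \<lfloor>2 ^ Suc n * x\<rfloor> then 1 else 0)" for x :: real
    proof -
      have "\<lfloor>2 ^ Suc n * x\<rfloor> = 2 * \<lfloor>2 ^ n * x\<rfloor> \<or> \<lfloor>2 ^ Suc n * x\<rfloor> = 2 * \<lfloor>2 ^ n * x\<rfloor> + 1"
        unfolding power_Suc mult.assoc by linarith
      thus ?thesis by auto
    qed
    have "\<lfloor>2 ^ n * \<theta>\<rfloor> = \<lfloor>2 ^ n * \<theta>'\<rfloor>"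
      using Suc by simp
    moreover have "odd \<lfloor>2 ^ Suc n * \<theta>\<rfloor> = odd \<lfloor>2 ^ Suc n * \<theta>'\<rfloor>"
      using Suc.prems[of n] by (simp add: binary_digit_def)
    ultimately show ?case
      using split[of \<theta>] split[of \<theta>'] by presburger
  qed
  hence "\<bar>2 ^ n * \<theta> - 2 ^ n * \<theta>'\<bar> \<le> 1" by linarith
  hence "2 ^ n * \<bar>\<theta> - \<theta>'\<bar> \<le> 1"
    by (simp add: abs_mult flip: right_diff_distrib)
  thus ?thesis by (simp add: field_simps)
qed

text \<open>
  Every block of \<open>k\<close> consecutive positions starts with a forced negative sign, which leaves room
  for \<open>k - 1\<close> binary digits; the digits are listed in order.
\<close>

definition sign_pattern :: "nat \<Rightarrow> real \<Rightarrow> nat \<Rightarrow> real" where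
  "sign_pattern k \<theta> j =
     (if j mod k \<noteq> 0 \<and> binary_digit \<theta> ((j div k) * (k - 1) + (j mod k - 1)) then 1 else -1)"

lemma frequently_negative_sign_pattern:
  assumes "k > 0"
  shows "frequently_negative k (sign_pattern k \<theta>)"
proof -
  have "\<exists>i<k. (j + i) mod k = 0" for j
  proof (cases "j mod k = 0")
    case True
    thus ?thesis using assms by (intro exI[of _ 0]) auto
  next
    case False
    have "j + (k - j mod k) = k * (j div k) + k"
      using assms mod_less_divisor[of k j] mult_div_mod_eq[of k j] by linarith
    hence "(j + (k - j mod k)) mod k = 0" by simp
    thus ?thesis using False assms by (intro exI[of _ "k - j mod k"]) auto
  qed
  thus ?thesis
    unfolding frequently_negative_def sign_pattern_def by (auto; metis)
qed

lemma abs_diff_le_if_sign_patterns_agree: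
  assumes \<theta>: "\<theta> \<in> {0..<1}" "\<theta>' \<in> {0..<1}" and k: "k \<ge> 2"
    and agree: "\<And>j. j < n \<Longrightarrow> sign_pattern k \<theta> j = sign_pattern k \<theta>' j"
  shows "\<bar>\<theta> - \<theta>'\<bar> \<le> 1 / 2 ^ ((n div k) * (k - 1))"
proof (rule abs_diff_le_if_binary_digits_agree[OF \<theta>])
  fix i assume i: "i < (n div k) * (k - 1)"
  \<comment> \<open>the position that carries the digit \<open>i\<close>\<close>
  define j where "j = (i div (k - 1)) * k + (i mod (k - 1) + 1)"
  have r: "i mod (k - 1) + 1 < k"
    using k mod_less_divisor[of "k - 1" i] by linarith
  have j_div: "j div k = i div (k - 1)" and j_mod: "j mod k = i mod (k - 1) + 1"
    using r k unfolding j_def by (simp_all add: div_mult_self3 del: One_nat_def add_Suc_right)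
  have "i div (k - 1) < n div k"
    using i k by (simp add: div_less_iff_less_mult)
  hence "(i div (k - 1) + 1) * k \<le> (n div k) * k"
    by (intro mult_right_mono) auto
  also have "\<dots> \<le> n" by simp
  finally have "j < n" using r by (simp add: j_def algebra_simps)
  from agree[OF this] show "binary_digit \<theta> i = binary_digit \<theta>' i"
    by (simp add: sign_pattern_def j_div j_mod div_mult_mod_eq split: if_splits)
qed

lemma sign_patterns_first_difference:
  assumes \<theta>: "\<theta> \<in> {0..<1}" "\<theta>' \<in> {0..<1}" "\<theta> \<noteq> \<theta>'" and k: "k \<ge> 2"
  obtains n where "sign_pattern k \<theta> n \<noteq> sign_pattern k \<theta>' n"
    "\<And>j. j < n \<Longrightarrow> sign_pattern k \<theta> j = sign_pattern k \<theta>' j"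
proof -
  have "\<exists>n. sign_pattern k \<theta> n \<noteq> sign_pattern k \<theta>' n"
  proof (rule ccontr)
    assume "\<not> ?thesis"
    hence bound: "\<bar>\<theta> - \<theta>'\<bar> \<le> 1 / 2 ^ ((n div k) * (k - 1))" for n
      using abs_diff_le_if_sign_patterns_agree[OF \<theta>(1,2) k] by blast
    obtain m where m: "1 / \<bar>\<theta> - \<theta>'\<bar> < 2 ^ m" using real_arch_pow[of 2] by auto
    have "(2::real) ^ m \<le> 2 ^ (m * (k - 1))" using k by (intro power_increasing) auto
    hence "1 / \<bar>\<theta> - \<theta>'\<bar> < 2 ^ (m * (k - 1))" using m by linarith
    with bound[of "m * k"] \<theta>(3) k show False by (simp add: field_simps)
  qed
  hence "sign_pattern k \<theta> (LEAST n. sign_pattern k \<theta> n \<noteq> sign_pattern k \<theta>' n) \<noteq>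
         sign_pattern k \<theta>' (LEAST n. sign_pattern k \<theta> n \<noteq> sign_pattern k \<theta>' n)"
    by (rule LeastI_ex)
  thus ?thesis
    using that not_less_Least by blast
qed

text \<open>
  Sign patterns with a negative sign every \<open>k\<close> steps carry entropy \<open>(1 - 1/k) log 2\<close>; the ratio
  of the entropy to the expansion rate \<open>log \<Lambda>\<close> is the Hoelder exponent that can be reached.
\<close>

lemma growth_rate_parameters:
  fixes s :: real
  assumes "0 \<le> s" "s < 1"
  obtains k :: nat and \<Lambda> :: real where "k \<ge> 2" "\<Lambda> > 2" "\<Lambda> powr s \<le> 2 powr (1 - 1 / k)"
proof (cases "s = 0")
  case True
  have "(3 :: real) powr s \<le> 2 powr (1 - 1 / real 2)"
    using True by (simp add: ge_one_powr_ge_zero)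
  thus ?thesis using that[of 2 3] by simp
next
  case False
  obtain m :: nat where "1 / (1 - s) < m" using reals_Archimedean2 by blast
  hence m: "1 < m * (1 - s)" using assms by (simp add: field_simps)
  define k where "k = max 2 m"
  have "real m * (1 - s) \<le> real k * (1 - s)" using assms by (intro mult_right_mono) (auto simp: k_def)
  hence "1 < k * (1 - s)" using m by linarith
  hence k: "s < 1 - 1 / k" by (simp add: field_simps k_def split: if_splits)
  define \<Lambda> :: real where "\<Lambda> = 2 powr ((1 - 1 / k) / s)"
  have "(1 - 1 / k) / s > 1" using k False assms by (simp add: field_simps)
  hence "2 powr 1 < \<Lambda>" unfolding \<Lambda>_def by (intro powr_less_mono) auto
  moreover have "\<Lambda> powr s = 2 powr (1 - 1 / k)"
    using False by (simp add: \<Lambda>_def powr_powr)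
  ultimately show ?thesis using that[of k \<Lambda>] by (simp add: k_def)
qed

text \<open>
  About a proportion \<open>1 - 1/k\<close> of the first \<open>n\<close> signs are binary digits, so two numbers \<open>D\<close>
  apart whose patterns first differ at time \<open>n\<close> satisfy \<open>D \<le> 2^k * 2^(-(1 - 1/k) n)\<close>, while
  their parameters are at least of order \<open>\<Lambda>^(-n)\<close> apart. The choice of \<open>k\<close> and \<open>\<Lambda>\<close> turns
  the one bound into the \<open>s\<close>-th power of the other.
\<close>

lemma holder_estimate:
  fixes s C e D \<Lambda> :: real
  assumes k: "k \<ge> 2" and \<Lambda>: "\<Lambda> > 2" "\<Lambda> powr s \<le> 2 powr (1 - 1 / k)" and s: "s \<ge> 0" and C: "C > 0"
    and D: "D \<le> 1 / 2 ^ ((n div k) * (k - 1))" and e: "1 \<le> C * \<Lambda> ^ n * e" "e \<ge> 0"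
  shows "D \<le> 2 ^ k * C powr s * e powr s"
proof -
  define p where "p = 1 - 1 / real k"
  have "real n \<le> real k * real (n div k) + real k"
  proof -
    have "n \<le> k * (n div k) + k"
      using k mod_less_divisor[of k n] mult_div_mod_eq[of k n] by linarith
    thus ?thesis by (metis of_nat_add of_nat_le_iff of_nat_mult)
  qed
  hence "p * real n \<le> p * (real k * real (n div k) + real k)"
    using k by (intro mult_left_mono) (auto simp: p_def)
  also have "\<dots> = real ((n div k) * (k - 1)) + (real k - 1)"
    using k by (simp add: p_def field_simps of_nat_diff)
  finally have exponent: "p * real n \<le> real ((n div k) * (k - 1)) + real k" by linarith
  have "1 powr s \<le> (C * \<Lambda> ^ n * e) powr s"
    using e s by (intro powr_mono2) auto
  also have "\<dots> = C powr s * (\<Lambda> powr s) powr n * e powr s"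
    using C \<Lambda> e by (simp add: powr_mult powr_powr mult.commute flip: powr_realpow)
  also have "\<dots> \<le> C powr s * (2 powr p) powr n * e powr s"
    using \<Lambda> C by (intro mult_left_mono mult_right_mono powr_mono2) (auto simp: p_def)
  also have "\<dots> = C powr s * 2 powr (p * real n) * e powr s"
    by (simp add: powr_powr)
  also have "\<dots> \<le> C powr s * 2 powr (real ((n div k) * (k - 1)) + real k) * e powr s"
    using exponent by (intro mult_left_mono mult_right_mono powr_mono) auto
  also have "\<dots> = 2 ^ ((n div k) * (k - 1)) * (2 ^ k * C powr s * e powr s)"
    by (simp add: powr_add powr_realpow del: of_nat_mult)
  finally have "1 / 2 ^ ((n div k) * (k - 1)) \<le> 2 ^ k * C powr s * e powr s"
    by (simp add: field_simps)
  with D show ?thesis by linarith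
qed

section \<open>The dimension of the non-recurrent real parameters\<close>

text \<open>
  The finitely many remaining points cannot be \<open>0\<close> either: then the critical point would be
  periodic, and its orbit would return to \<open>0\<close> at arbitrarily late times.
\<close>

lemma critically_non_recurrent_if_eventually_bounded_away:
  assumes d: "d > 0" and away: "\<And>j. d \<le> \<bar>crit_orbit c (N + j)\<bar>"
  shows "critically_non_recurrent (of_real c)"
proof -
  have nonzero: "crit_orbit c m \<noteq> 0" if m: "m \<ge> 1" for m
  proof
    assume zero: "crit_orbit c m = 0"
    have shift: "crit_orbit c (m + n) = crit_orbit c n" for n
      by (induction n) (auto simp: zero)
    have "crit_orbit c (i * m) = 0" for i
      by (induction i) (auto simp: shift)
    moreover have "N * m = N + N * (m - 1)"
      using m by (cases m) auto
    ultimately have "crit_orbit c (N + N * (m - 1)) = 0" by metis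
    with away[of "N * (m - 1)"] d show False by simp
  qed
  let ?F = "(\<lambda>n. complex_of_real (crit_orbit c n)) ` {1..<N}"
  let ?G = "{z :: complex. d \<le> cmod z}"
  have "{(Q (of_real c) ^^ n) 0 |n. n \<ge> 1} \<subseteq> ?F \<union> ?G"
  proof
    fix z assume "z \<in> {(Q (of_real c) ^^ n) 0 |n. n \<ge> 1}"
    then obtain n where n: "n \<ge> 1" "z = complex_of_real (crit_orbit c n)"
      by (auto simp: Q_iterate_of_real)
    show "z \<in> ?F \<union> ?G"
    proof (cases "n < N")
      case False
      thus ?thesis using away[of "n - N"] n by simp
    qed (use n in auto)
  qed
  moreover have "closed ?G" by (intro closed_Collect_le continuous_intros)
  hence "closed (?F \<union> ?G)" by (intro closed_Un[OF finite_imp_closed]) auto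
  ultimately have "closure {(Q (of_real c) ^^ n) 0 |n. n \<ge> 1} \<subseteq> ?F \<union> ?G"
    by (rule closure_minimal)
  moreover have "0 \<notin> ?F \<union> ?G" using nonzero d by (auto simp: image_iff)
  ultimately show ?thesis unfolding critically_non_recurrent_def by blast
qed

lemma of_real_in_mandelbrot:
  assumes "-2 \<le> c" "c \<le> 0"
  shows "complex_of_real c \<in> mandelbrot"
proof (rule mandelbrot_if_critical_point_in_filled_julia)
  have "cmod ((Q (of_real c) ^^ n) 0) \<le> escape_radius (of_real c)" for n
    using abs_crit_orbit_le_2[OF assms, of n] by (simp add: Q_iterate_of_real escape_radius_def)
  thus "0 \<in> filled_julia (of_real c)" by (simp add: filled_julia_iff)
qed

text \<open>
  Choose a parameter \<open>p \<theta>\<close> realising the sign pattern of each \<open>\<theta> \<in> [0, 1)\<close>. Each \<open>p \<theta>\<close> is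
  non-recurrent and belongs to the Mandelbrot set, but it could be an interior point. The set \<open>E\<close>
  of these exceptional \<open>\<theta>\<close> is countable: near an interior point the critical orbits form a
  uniformly Lipschitz family, whereas two distinct parameters \<open>p \<theta>\<close> and \<open>p \<theta>'\<close> have orbits
  that are \<open>2 d\<close> apart at some time. So the exceptional parameters are isolated from each other.
\<close>

lemma hausdorff_measure_nonrecurrent_parameters_nonzero:
  assumes s: "0 \<le> s" "s < 1"
  shows "hausdorff_measure s {c \<in> frontier mandelbrot \<inter> \<real>. critically_non_recurrent c} \<noteq> 0"
proof -
  obtain k :: nat and \<Lambda> :: real where k: "k \<ge> 2" and \<Lambda>: "\<Lambda> > 2" "\<Lambda> powr s \<le> 2 powr (1 - 1 / k)"
    using growth_rate_parameters[OF s] by blast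
  define b where "b = radical_bound k"
  define d where "d = sqrt ((2 - b) / 2)"
  have b: "b < 2" and d: "d > 0" using radical_bound_range[of k] by (auto simp: b_def d_def)
  obtain \<eta>' where "\<eta>' > 0" and separation:
    "\<And>N. \<exists>C>0. \<forall>c\<in>{-2..-2 + \<eta>'}. \<forall>c'\<in>{-2..-2 + \<eta>'}. \<forall>n.
       (\<forall>j. d \<le> \<bar>crit_orbit c (N + j)\<bar> \<and> \<bar>crit_orbit c (N + j)\<bar> \<le> b) \<longrightarrow>
       2 * d \<le> \<bar>crit_orbit c (N + n) - crit_orbit c' (N + n)\<bar> \<longrightarrow> 1 \<le> C * \<Lambda> ^ n * \<bar>c - c'\<bar>"
    using orbit_separation_bound[OF \<Lambda>(1) d b] by blast
  define \<eta> where "\<eta> = min \<eta>' (min (1/2) ((2 - b) / 2))"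
  have \<eta>: "0 < \<eta>" "\<eta> \<le> 1/2" "\<eta> \<le> (2 - radical_bound k) / 2" "\<eta> \<le> \<eta>'"
  proof -
    show "\<eta> \<le> (2 - radical_bound k) / 2"
      unfolding \<eta>_def b_def by (rule min.coboundedI2[OF min.cobounded2])
  qed (use \<open>\<eta>' > 0\<close> b in \<open>auto simp: \<eta>_def\<close>)
  obtain N where "\<And>\<sigma>. frequently_negative k \<sigma> \<Longrightarrow>
      \<exists>c\<in>{-2..-2 + \<eta>}. \<forall>j. \<sigma> j * crit_orbit c (N + j) \<in> {d..b}"
    using sign_pattern_realised[OF \<eta>(1-3)] unfolding b_def d_def by blast
  hence "\<exists>c\<in>{-2..-2 + \<eta>}. \<forall>j. sign_pattern k \<theta> j * crit_orbit c (N + j) \<in> {d..b}" for \<theta>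
    using frequently_negative_sign_pattern k by simp
  then obtain p where p_range: "\<And>\<theta>. p \<theta> \<in> {-2..-2 + \<eta>}"
    and p_orbit: "\<And>\<theta> j. sign_pattern k \<theta> j * crit_orbit (p \<theta>) (N + j) \<in> {d..b}"
    by metis
  obtain C where C: "C > 0" and C_bound:
    "\<And>c c' n. c \<in> {-2..-2 + \<eta>'} \<Longrightarrow> c' \<in> {-2..-2 + \<eta>'} \<Longrightarrow>
       (\<And>j. d \<le> \<bar>crit_orbit c (N + j)\<bar> \<and> \<bar>crit_orbit c (N + j)\<bar> \<le> b) \<Longrightarrow>
       2 * d \<le> \<bar>crit_orbit c (N + n) - crit_orbit c' (N + n)\<bar> \<Longrightarrow> 1 \<le> C * \<Lambda> ^ n * \<bar>c - c'\<bar>"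
    using separation[of N] by blast
  have p_range': "p \<theta> \<in> {-2..-2 + \<eta>'}" "-2 \<le> p \<theta>" "p \<theta> \<le> 0" for \<theta>
    using p_range[of \<theta>] \<eta> by auto
  have signs: "sign_pattern k \<theta> j = 1 \<or> sign_pattern k \<theta> j = -1" for \<theta> j
    by (simp add: sign_pattern_def)
  have p_abs: "d \<le> \<bar>crit_orbit (p \<theta>) (N + j)\<bar> \<and> \<bar>crit_orbit (p \<theta>) (N + j)\<bar> \<le> b" for \<theta> j
    using p_orbit[of \<theta> j] signs[of \<theta> j] d by auto
  have apart: "2 * d \<le> \<bar>crit_orbit (p \<theta>) (N + n) - crit_orbit (p \<theta>') (N + n)\<bar>"
    if "sign_pattern k \<theta> n \<noteq> sign_pattern k \<theta>' n" for \<theta> \<theta>' n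
    using p_orbit[of \<theta> n] p_orbit[of \<theta>' n] signs[of \<theta> n] signs[of \<theta>' n] that by auto

  define E where "E = {\<theta> \<in> {0..<1}. complex_of_real (p \<theta>) \<in> interior mandelbrot}"
  have separated: "p \<theta>' = p \<theta> \<longleftrightarrow> \<theta>' = \<theta>" if \<theta>: "\<theta> \<in> {0..<1}" "\<theta>' \<in> {0..<1}" for \<theta> \<theta>'
  proof
    assume eq: "p \<theta>' = p \<theta>"
    show "\<theta>' = \<theta>"
    proof (rule ccontr)
      assume "\<theta>' \<noteq> \<theta>"
      then obtain n where "sign_pattern k \<theta>' n \<noteq> sign_pattern k \<theta> n"
        using sign_patterns_first_difference[OF \<theta>(2,1) _ k] by blast
      from apart[OF this] eq d show False by simp
    qed
  qed simp
  have "\<exists>T. open T \<and> T \<inter> p ` E = {c}" if c: "c \<in> p ` E" for c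
  proof -
    obtain \<theta> where \<theta>: "\<theta> \<in> E" "c = p \<theta>" using c by blast
    obtain r B where r: "r > 0" and B: "B > 0" and lipschitz: "\<And>n c'. dist (complex_of_real c) c' < r \<Longrightarrow>
        cmod ((Q c' ^^ n) 0 - (Q (of_real c) ^^ n) 0) \<le> B * dist (complex_of_real c) c'"
      using critical_orbit_lipschitz_in_interior_mandelbrot[of "of_real c"] \<theta> by (auto simp: E_def)
    have "c' = c" if c': "c' \<in> p ` E" "dist c c' < min r (2 * d / B)" for c'
    proof (rule ccontr)
      assume "c' \<noteq> c"
      obtain \<theta>' where \<theta>': "\<theta>' \<in> E" "c' = p \<theta>'" using c'(1) by blast
      obtain n where "sign_pattern k \<theta>' n \<noteq> sign_pattern k \<theta> n"
        using sign_patterns_first_difference[of \<theta>' \<theta> k] \<theta> \<theta>' \<open>c' \<noteq> c\<close> k by (auto simp: E_def)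
      from apart[OF this] have "2 * d \<le> \<bar>crit_orbit c' (N + n) - crit_orbit c (N + n)\<bar>"
        by (simp add: \<theta> \<theta>')
      also have "\<dots> \<le> B * dist c c'"
        using lipschitz[of "of_real c'" "N + n"] c'(2)
        by (simp add: Q_iterate_of_real dist_norm flip: of_real_diff)
      also have "\<dots> < 2 * d" using c'(2) B by (simp add: field_simps)
      finally show False by simp
    qed
    hence "ball c (min r (2 * d / B)) \<inter> p ` E = {c}"
      using c r B d by (auto simp: mem_ball)
    thus ?thesis by (intro exI[of _ "ball c (min r (2 * d / B))"]) auto
  qed
  hence "countable (p ` E)" by (rule countable_isolated_points)
  moreover have "inj_on p E"
    using separated by (auto simp: inj_on_def E_def)
  ultimately have countable_E: "countable E"
    by (rule countable_image_inj_on)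

  show ?thesis
  proof (rule hausdorff_measure_nonzero_if_holder_chart[where \<gamma> = "\<lambda>\<theta>. complex_of_real (p \<theta>)"])
    show "countable E" by (rule countable_E)
    show "2 ^ k * C powr s > 0" using C by simp
    show "complex_of_real (p \<theta>) \<in> {c \<in> frontier mandelbrot \<inter> \<real>. critically_non_recurrent c}"
      if "\<theta> \<in> {0..<1} - E" for \<theta>
    proof -
      have "complex_of_real (p \<theta>) \<in> frontier mandelbrot"
        using that of_real_in_mandelbrot[OF p_range'(2,3)] closure_subset
        by (auto simp: frontier_def E_def)
      thus ?thesis
        using critically_non_recurrent_if_eventually_bounded_away[OF d] p_abs by auto
    qed
    show "\<bar>\<theta> - \<theta>'\<bar> \<le> 2 ^ k * C powr s * dist (complex_of_real (p \<theta>)) (complex_of_real (p \<theta>')) powr s"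
      if \<theta>: "\<theta> \<in> {0..<1}" "\<theta>' \<in> {0..<1}" "\<theta> \<noteq> \<theta>'" for \<theta> \<theta>'
    proof -
      obtain n where n: "sign_pattern k \<theta> n \<noteq> sign_pattern k \<theta>' n"
        "\<And>j. j < n \<Longrightarrow> sign_pattern k \<theta> j = sign_pattern k \<theta>' j"
        using sign_patterns_first_difference[OF \<theta> k] by blast
      show ?thesis
      proof (rule holder_estimate[OF k \<Lambda> s(1) C])
        show "\<bar>\<theta> - \<theta>'\<bar> \<le> 1 / 2 ^ ((n div k) * (k - 1))"
          using abs_diff_le_if_sign_patterns_agree[OF \<theta>(1,2) k n(2)] .
        show "1 \<le> C * \<Lambda> ^ n * dist (complex_of_real (p \<theta>)) (complex_of_real (p \<theta>'))"
          using C_bound[OF p_range'(1) p_range'(1) p_abs apart[OF n(1)]]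
          by (simp add: dist_norm flip: of_real_diff)
      qed simp
    qed
  qed (use s in auto)
qed

theorem theorem1p4:
  shows "hausdorff_dim {c \<in> frontier mandelbrot \<inter> \<real>. critically_non_recurrent c} = 1"
proof (rule hausdorff_dim_eq_1)
  let ?A = "{c \<in> frontier mandelbrot \<inter> \<real>. critically_non_recurrent c}"
  show "hausdorff_measure s ?A = 0" if "s > 1" for s
  proof (rule hausdorff_measure_bounded_real_eq_0[where a = 2])
    have "closure mandelbrot \<subseteq> cball 0 2"
      using mandelbrot_subset_cball by (intro closure_minimal) auto
    thus "?A \<subseteq> cball 0 2" by (auto simp: frontier_def)
  qed (use that in auto)
  show "hausdorff_measure s ?A \<noteq> 0" if "0 \<le> s" "s < 1" for s
    using that by (rule hausdorff_measure_nonrecurrent_parameters_nonzero)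
qed

end
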